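(* Let $\mathfrak{n}$ be a (real, non-abelian) nilpotent Lie algebra of dimension $n$ with Lie bracket $[\cdot,\cdot]$, endowed with a basis $\{e_1,\dots,e_n\}$ (used to identify $\mathfrak{n}$ with $\mathbb{R}^n$), and let $D\in\operatorname{Der}(\mathfrak{n})\cap\mathfrak{t}^n$ with $\operatorname{tr} D>0$. Then the following conditions are equivalent: (i) $D$ is Ricci negative. (ii) $D\in\mathbb{R}_{>0}\,\big(m\left(G_D\cdot[\cdot,\cdot]\right)\cap\mathfrak{t}^n\big)+\mathfrak{t}^n_{>0}$. (iii) $D\in\mathbb{R}_{>0}\,\big(m\left(\overline{G_D\cdot[\cdot,\cdot]}\right)\cap\mathfrak{t}^n\big)+\mathfrak{t}^n_{>0}$. (iv) $D\in\mathbb{R}_{>0}\,\big(m\left(\overline{G_D\cdot[\cdot,\cdot]}\right)\cap\mathfrak{a}_+^D\big)+\mathfrak{t}^n_{>0}$, where $\mathfrak{a}_+^D\subset\mathfrak{t}^n$ is any Weyl chamber of $G_D$.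
   Context: Notation: $\mathfrak{t}^n$ is the set of real diagonal $n\times n$ matrices and $\mathfrak{t}^n_{>0}$ the subset of those with all diagonal entries positive. $\operatorname{Der}(\mathfrak{n})$ is the Lie algebra of derivations of $\mathfrak{n}$, written as matrices in the given basis. Ricci negative derivation: for $D\in\operatorname{Der}(\mathfrak{n})$ let $\mathfrak{s}=\mathbb{R}f\oplus\mathfrak{n}$ be the solvable Lie algebra given by the semidirect sum with $\operatorname{ad} f|_{\mathfrak{n}}=D$. A derivation $D$ with $\operatorname{tr}D>0$ is called Ricci negative if $\mathfrak{s}$ admits an inner product such that $D$ is symmetric with respect to it ($D^t=D$), $f\perp\mathfrak{n}$, and the corresponding left-invariant metric on the simply connected Lie group with Lie algebra $\mathfrak{s}$ has negative definite Ricci curvature. Action: $V=\Lambda^2(\mathbb{R}^n)^*\otimes\mathbb{R}^n$ is the space of skew-symmetric bilinear maps $\mathbb{R}^n\times\mathbb{R}^n\to\mathbb{R}^n$, with the $\mathrm{GL}_n(\mathbb{R})$-action $g\cdot\mu=g\mu(g^{-1}\cdot,g^{-1}\cdot)$ and derived action $E\cdot\mu=E\mu(\cdot,\cdot)-\mu(E\cdot,\cdot)-\mu(\cdot,E\cdot)$. The bracket of $\mathfrak{n}$ is regarded as an element of $V$. $G_D$ is the identity component of the centralizer of $D$ in $\mathrm{GL}_n(\mathbb{R})$, and the bar denotes closure in $V$. Moment map: give $V$ the inner product making $\{(e^i\wedge e^j)\otimes e_k: i<j\}$ orthonormal (where $(e^i\wedge e^j)\otimes e_k$ is the bilinear map sending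 $(e_i,e_j)\mapsto e_k$, $(e_j,e_i)\mapsto -e_k$ and all other pairs of basis vectors to $0$) and $\mathfrak{gl}_n(\mathbb{R})$ the inner product $\langle A,B\rangle=\operatorname{tr}AB^t$. The map $m:V\smallsetminus\{0\}\to\operatorname{sym}(n)$ (symmetric matrices) is defined by $\langle m(\mu),E\rangle=\frac{1}{|\mu|^2}\langle E\cdot\mu,\mu\rangle$ for all $E\in\operatorname{sym}(n)$. For $S\subset V$, $m(S)$ means $m(S\smallsetminus\{0\})$. For sets, $\mathbb{R}_{>0}A+B=\{ra+b: r>0, a\in A, b\in B\}$. Weyl chambers of $G_D$: $\mathfrak{t}^n$ is a maximal abelian subalgebra of $\mathfrak{g}_D\cap\operatorname{sym}(n)$, where $\mathfrak{g}_D$ is the Lie algebra of $G_D$. Concretely, if $D=\operatorname{diag}(d_1,\dots,d_n)$ and $\{1,\dots,n\}$ is partitioned into blocks of indices with equal $d_i$, a (closed) Weyl chamber in $\mathfrak{t}^n$ is obtained by choosing a total order on each block and taking all $\operatorname{diag}(a_1,\dots,a_n)$ whose entries are non-decreasing along each block with respect to the chosen order (no condition between different blocks). *)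

theory Defs
  imports "HOL-Analysis.Analysis"
begin

section \<open>Lie algebras\<close>

definition lie_algebra :: "('a::real_vector \<Rightarrow> 'a \<Rightarrow> 'a) \<Rightarrow> bool" where
  "lie_algebra br \<longleftrightarrow> bilinear br \<and> (\<forall>x. br x x = 0) \<and>
     (\<forall>x y z. br x (br y z) + br y (br z x) + br z (br x y) = 0)"

fun lower_central_series :: "('a::real_vector \<Rightarrow> 'a \<Rightarrow> 'a) \<Rightarrow> nat \<Rightarrow> 'a set" where
  "lower_central_series br 0 = UNIV"
| "lower_central_series br (Suc k) = span {br x y |x y. y \<in> lower_central_series br k}"

definition nilpotent_lie_algebra :: "('a::real_vector \<Rightarrow> 'a \<Rightarrow> 'a) \<Rightarrow> bool" where
  "nilpotent_lie_algebra br \<longleftrightarrow> lie_algebra br \<and> (\<exists>k. lower_central_series br k = {0})"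

definition abelian_lie_algebra :: "('a::real_vector \<Rightarrow> 'a \<Rightarrow> 'a) \<Rightarrow> bool" where
  "abelian_lie_algebra br \<longleftrightarrow> lie_algebra br \<and> (\<forall>x y. br x y = 0)"

definition Der :: "(real^'n \<Rightarrow> real^'n \<Rightarrow> real^'n) \<Rightarrow> (real^'n^'n) set" where
  "Der br = {D. \<forall>x y. D *v br x y = br (D *v x) y + br x (D *v y)}"

text \<open>The Lie algebra \<open>\<real>f \<oplus> \<nn>\<close> on \<open>\<real> \<times> \<nn>\<close>, with \<open>f = (1, 0)\<close> and \<open>[f, x] = D x\<close>.\<close>

definition semidirect_bracket ::
  "(real^'n \<Rightarrow> real^'n \<Rightarrow> real^'n) \<Rightarrow> real^'n^'n \<Rightarrow>
     real \<times> (real^'n) \<Rightarrow> real \<times> (real^'n) \<Rightarrow> real \<times> (real^'n)" where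
  "semidirect_bracket br D = (\<lambda>(a, x) (b, y). (0, a *\<^sub>R (D *v y) - b *\<^sub>R (D *v x) + br x y))"


section \<open>Ricci curvature of left-invariant metrics\<close>

definition is_inner_product :: "('a::real_vector \<Rightarrow> 'a \<Rightarrow> real) \<Rightarrow> bool" where
  "is_inner_product g \<longleftrightarrow> bilinear g \<and> (\<forall>x y. g x y = g y x) \<and> (\<forall>x. x \<noteq> 0 \<longrightarrow> g x x > 0)"

text \<open>
  A left-invariant metric on a Lie group is an inner product \<open>g\<close> on its Lie algebra of
  left-invariant vector fields. Its Levi-Civita connection is left-invariant, so it restricts to a
  bilinear operation on the Lie algebra, and that restriction is the unique one that is
  torsion-free and compatible with the metric. The derivative terms \<open>X (g(Y, Z))\<close> are absent
  because \<open>g(Y, Z)\<close> is a constant function for left-invariant \<open>Y\<close> and \<open>Z\<close>.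
\<close>

definition levi_civita ::
  "('a::real_vector \<Rightarrow> 'a \<Rightarrow> 'a) \<Rightarrow> ('a \<Rightarrow> 'a \<Rightarrow> real) \<Rightarrow> 'a \<Rightarrow> 'a \<Rightarrow> 'a" where
  "levi_civita br g = (THE nabla. bilinear nabla \<and>
     (\<forall>X Y. nabla X Y - nabla Y X = br X Y) \<and>
     (\<forall>X Y Z. g (nabla X Y) Z + g Y (nabla X Z) = 0))"

definition riemann_curvature ::
  "('a::real_vector \<Rightarrow> 'a \<Rightarrow> 'a) \<Rightarrow> ('a \<Rightarrow> 'a \<Rightarrow> real) \<Rightarrow> 'a \<Rightarrow> 'a \<Rightarrow> 'a \<Rightarrow> 'a" where
  "riemann_curvature br g X Y Z =
     (let nabla = levi_civita br g in
      nabla X (nabla Y Z) - nabla Y (nabla X Z) - nabla (br X Y) Z)"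

text \<open>
  The trace of an endomorphism. It does not depend on the basis, so the inner product of the
  type class serves only to read off coordinates; it is unrelated to the metric \<open>g\<close>.
\<close>

definition endo_trace :: "('a::euclidean_space \<Rightarrow> 'a) \<Rightarrow> real" where
  "endo_trace T = (\<Sum>b\<in>Basis. T b \<bullet> b)"

definition ricci_curvature ::
  "('a::euclidean_space \<Rightarrow> 'a \<Rightarrow> 'a) \<Rightarrow> ('a \<Rightarrow> 'a \<Rightarrow> real) \<Rightarrow> 'a \<Rightarrow> 'a \<Rightarrow> real" where
  "ricci_curvature br g X Y = endo_trace (\<lambda>Z. riemann_curvature br g Z X Y)"

definition ricci_negative :: "(real^'n \<Rightarrow> real^'n \<Rightarrow> real^'n) \<Rightarrow> real^'n^'n \<Rightarrow> bool" where
  "ricci_negative br D \<longleftrightarrow> D \<in> Der br \<and> trace D > 0 \<and>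
     (\<exists>g. is_inner_product g \<and>
        (\<forall>x y. g (0, D *v x) (0, y) = g (0, x) (0, D *v y)) \<and>
        (\<forall>x. g (1, 0) (0, x) = 0) \<and>
        (\<forall>X. X \<noteq> 0 \<longrightarrow> ricci_curvature (semidirect_bracket br D) g X X < 0))"


section \<open>The action on skew-symmetric bilinear maps\<close>

definition skew_bilinear_maps :: "(real^'n \<Rightarrow> real^'n \<Rightarrow> real^'n) set" where
  "skew_bilinear_maps = {\<mu>. bilinear \<mu> \<and> (\<forall>x y. \<mu> x y = - \<mu> y x)}"

definition GL_action ::
  "real^'n^'n \<Rightarrow> (real^'n \<Rightarrow> real^'n \<Rightarrow> real^'n) \<Rightarrow> real^'n \<Rightarrow> real^'n \<Rightarrow> real^'n" where
  "GL_action h \<mu> = (\<lambda>x y. h *v \<mu> (matrix_inv h *v x) (matrix_inv h *v y))"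

definition gl_action ::
  "real^'n^'n \<Rightarrow> (real^'n \<Rightarrow> real^'n \<Rightarrow> real^'n) \<Rightarrow> real^'n \<Rightarrow> real^'n \<Rightarrow> real^'n" where
  "gl_action E \<mu> = (\<lambda>x y. E *v \<mu> x y - \<mu> (E *v x) y - \<mu> x (E *v y))"

definition centralizer_GL :: "real^'n^'n \<Rightarrow> (real^'n^'n) set" where
  "centralizer_GL D = {h. invertible h \<and> h ** D = D ** h}"

definition G_group :: "real^'n^'n \<Rightarrow> (real^'n^'n) set" where
  "G_group D = connected_component_set (centralizer_GL D) (mat 1)"

definition G_orbit ::
  "real^'n^'n \<Rightarrow> (real^'n \<Rightarrow> real^'n \<Rightarrow> real^'n) \<Rightarrow> (real^'n \<Rightarrow> real^'n \<Rightarrow> real^'n) set" where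
  "G_orbit D \<mu> = (\<lambda>h. GL_action h \<mu>) ` G_group D"

text \<open>
  The library topology on functions is that of pointwise convergence. On the finite-dimensional
  space of skew-symmetric bilinear maps it is the usual vector space topology; see
  \<open>closure_in_V_iff\<close> below.
\<close>

definition closure_in_V ::
  "(real^'n \<Rightarrow> real^'n \<Rightarrow> real^'n) set \<Rightarrow> (real^'n \<Rightarrow> real^'n \<Rightarrow> real^'n) set" where
  "closure_in_V S = (top_of_set skew_bilinear_maps) closure_of S"


section \<open>The moment map\<close>

text \<open>
  The factor \<open>1/2\<close> compensates for summing over all ordered pairs \<open>(i, j)\<close> instead of \<open>i < j\<close>
  (the index type carries no order); see \<open>V_inner_elementary\<close> below.
\<close>

definition V_inner ::
  "(real^'n \<Rightarrow> real^'n \<Rightarrow> real^'n) \<Rightarrow> (real^'n \<Rightarrow> real^'n \<Rightarrow> real^'n) \<Rightarrow> real" where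
  "V_inner \<mu> \<nu> = (1/2) * (\<Sum>i\<in>UNIV. \<Sum>j\<in>UNIV. \<mu> (axis i 1) (axis j 1) \<bullet> \<nu> (axis i 1) (axis j 1))"

definition symmetric_matrices :: "(real^'n^'n) set" where
  "symmetric_matrices = {M. transpose M = M}"

definition moment_map :: "(real^'n \<Rightarrow> real^'n \<Rightarrow> real^'n) \<Rightarrow> real^'n^'n" where
  "moment_map \<mu> = (THE M. M \<in> symmetric_matrices \<and>
     (\<forall>E\<in>symmetric_matrices. trace (M ** transpose E) = V_inner (gl_action E \<mu>) \<mu> / V_inner \<mu> \<mu>))"

definition moment_image :: "(real^'n \<Rightarrow> real^'n \<Rightarrow> real^'n) set \<Rightarrow> (real^'n^'n) set" where
  "moment_image S = moment_map ` (S - {\<lambda>x y. 0})"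


section \<open>Diagonal matrices, cones and Weyl chambers\<close>

definition diagonal_matrices :: "(real^'n^'n) set" where
  "diagonal_matrices = {A. \<forall>i j. i \<noteq> j \<longrightarrow> A $ i $ j = 0}"

definition positive_diagonal_matrices :: "(real^'n^'n) set" where
  "positive_diagonal_matrices = {A \<in> diagonal_matrices. \<forall>i. A $ i $ i > 0}"

definition positive_cone_plus :: "'a::real_vector set \<Rightarrow> 'a set \<Rightarrow> 'a set" where
  "positive_cone_plus A B = {r *\<^sub>R a + b |r a b. r > 0 \<and> a \<in> A \<and> b \<in> B}"

text \<open>
  A total order on each block of equal diagonal entries of \<open>D\<close> is given as a family \<open>R\<close> of
  relations indexed by the common value \<open>c\<close>; a value that does not occur has an empty block.
\<close>

definition weyl_chambers :: "real^'n^'n \<Rightarrow> (real^'n^'n) set set" where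
  "weyl_chambers D = {\<aa>. \<exists>R. (\<forall>c. linear_order_on {i. D $ i $ i = c} (R c)) \<and>
     \<aa> = {A \<in> diagonal_matrices. \<forall>c. \<forall>(i, j)\<in>R c. A $ i $ i \<le> A $ j $ j}}"


section \<open>The defining conditions determine the connection, the moment map and the topology\<close>

lemma inner_product_riesz:
  fixes g :: "'a::euclidean_space \<Rightarrow> 'a \<Rightarrow> real"
  assumes "is_inner_product g" and "linear \<phi>"
  shows "\<exists>z. \<forall>w. g z w = \<phi> w"
proof -
  have bil: "bilinear g" and pos: "\<And>x. x \<noteq> 0 \<Longrightarrow> g x x > 0"
    using assms(1) by (auto simp: is_inner_product_def)
  have lr: "linear (g x)" and ll: "linear (\<lambda>y. g y x)" for x
    using bil by (auto simp: bilinear_def)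
  define T where "T z = (\<Sum>b\<in>Basis. g z b *\<^sub>R b)" for z
  have Tw: "g z w = T z \<bullet> w" for z w
  proof -
    have "g z w = g z (\<Sum>b\<in>Basis. (w \<bullet> b) *\<^sub>R b)" by (simp add: euclidean_representation)
    also have "\<dots> = (\<Sum>b\<in>Basis. (w \<bullet> b) * g z b)"
      by (simp add: linear_sum[OF lr] linear_scale[OF lr])
    also have "\<dots> = T z \<bullet> w"
      by (simp add: T_def inner_sum_left inner_commute[of w] mult.commute)
    finally show ?thesis .
  qed
  have linT: "linear T"
    unfolding T_def
    by (rule linearI)
       (simp_all add: linear_add[OF ll] linear_scale[OF ll] algebra_simps sum.distrib scaleR_sum_right)
  have "inj T"
  proof (subst linear_injective_0[OF linT], intro allI impI)
    fix z assume "T z = 0"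
    then have "g z z = 0" by (simp add: Tw)
    then show "z = 0" using pos[of z] by force
  qed
  then have "surj T" using linT linear_injective_imp_surjective by blast
  then obtain z where z: "T z = (\<Sum>b\<in>Basis. \<phi> b *\<^sub>R b)" by (metis surjD)
  have "g z w = \<phi> w" for w
  proof -
    have "\<phi> w = \<phi> (\<Sum>b\<in>Basis. (w \<bullet> b) *\<^sub>R b)" by (simp add: euclidean_representation)
    also have "\<dots> = (\<Sum>b\<in>Basis. (w \<bullet> b) * \<phi> b)"
      by (simp add: linear_sum[OF assms(2)] linear_scale[OF assms(2)])
    also have "\<dots> = T z \<bullet> w"
      by (simp add: z inner_sum_left inner_commute[of w] mult.commute)
    finally show ?thesis by (simp add: Tw)
  qed
  then show ?thesis by blast
qed

lemma levi_civita_ex1: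
  fixes br :: "'a::euclidean_space \<Rightarrow> 'a \<Rightarrow> 'a"
  assumes "lie_algebra br" and "is_inner_product g"
  shows "\<exists>!nabla. bilinear nabla \<and>
     (\<forall>X Y. nabla X Y - nabla Y X = br X Y) \<and>
     (\<forall>X Y Z. g (nabla X Y) Z + g Y (nabla X Z) = 0)"
proof -
  have bil: "bilinear g" and sym: "\<And>x y. g x y = g y x" and pos: "\<And>x. x \<noteq> 0 \<Longrightarrow> g x x > 0"
    using assms(2) by (auto simp: is_inner_product_def)
  have bb: "bilinear br" and alt: "\<And>x. br x x = 0"
    using assms(1) by (auto simp: lie_algebra_def)
  note bs = bilinear_ladd bilinear_radd bilinear_lmul bilinear_rmul
    bilinear_lsub bilinear_rsub bilinear_lneg bilinear_rneg
  note gs = bs[OF bil] and brs = bs[OF bb]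
  have anti: "br y x = - br x y" for x y
  proof -
    have "br (x + y) (x + y) = br x x + br x y + (br y x + br y y)"
      by (simp only: brs(1,2) add_ac)
    then have "br x y + br y x = 0" by (simp add: alt)
    then show ?thesis by (simp add: add_eq_0_iff)
  qed
  have eqI: "u = v" if "\<And>w. g u w = g v w" for u v
  proof (rule ccontr)
    assume "u \<noteq> v"
    then have "g (u - v) (u - v) > 0" using pos by simp
    then show False using that[of "u - v"] by (simp add: gs)
  qed
  define K where "K X Y Z = (g (br X Y) Z - g (br Y Z) X + g (br Z X) Y) / 2" for X Y Z
  have "linear (K X Y)" for X Y
    unfolding K_def by (rule linearI) (simp_all add: gs brs field_simps)
  then have "\<forall>X Y. \<exists>z. \<forall>w. g z w = K X Y w"
    using inner_product_riesz[OF assms(2)] by blast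
  then obtain N where N: "\<And>X Y w. g (N X Y) w = K X Y w" by metis
  have "bilinear N"
    unfolding bilinear_def
    by (intro conjI allI linearI eqI) (simp_all add: gs N, simp_all add: K_def gs brs field_simps)
  moreover have "N X Y - N Y X = br X Y" for X Y
  proof (rule eqI)
    fix w
    show "g (N X Y - N Y X) w = g (br X Y) w"
      using anti[of X Y] anti[of w X] anti[of w Y] by (simp add: gs N K_def field_simps)
  qed
  moreover have "g (N X Y) Z + g Y (N X Z) = 0" for X Y Z
    using anti[of X Y] anti[of X Z] anti[of Y Z] by (simp add: sym[of Y] gs N K_def field_simps)
  moreover have "M = N" if M: "\<forall>X Y. M X Y - M Y X = br X Y"
      "\<forall>X Y Z. g (M X Y) Z + g Y (M X Z) = 0" for M
  proof (intro ext eqI)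
    fix X Y Z
    have t: "M A B = M B A + br A B" for A B using M(1) by (metis add_diff_cancel_left' diff_add_cancel)
    have m: "g (M A B) C = - g B (M A C)" for A B C using M(2) by (simp add: add_eq_0_iff)
    have s: "g (M A B) C = g (M B A) C + g (br A B) C" for A B C by (subst t) (simp add: gs)
    have c: "g (M A B) C = - g (M A C) B" for A B C using m sym by metis
    show "g (M X Y) Z = g (N X Y) Z"
      using s[of X Y Z] s[of Y Z X] s[of Z X Y] c[of X Y Z] c[of Y Z X] c[of Z X Y]
      unfolding N K_def by (simp add: field_simps)
  qed
  ultimately show ?thesis
    by (intro ex1I[of _ N] conjI allI) (assumption | (elim conjE, simp))+
qed

lemma V_inner_elementary:
  fixes i j k p q r :: "'n::finite"
  defines "w \<equiv> \<lambda>i j k (x::real^'n) (y::real^'n). (x $ i * y $ j - x $ j * y $ i) *\<^sub>R (axis k 1 :: real^'n)"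
  assumes "i \<noteq> j" "p \<noteq> q" "(p, q) \<noteq> (j, i)"
  shows "V_inner (w i j k) (w p q r) = (if i = p \<and> j = q \<and> k = r then 1 else 0)"
proof -
  have ax: "(axis a (1::real) :: real^'n) $ b = (if a = b then 1 else 0)" for a b
    by (simp add: axis_def)
  let ?c = "if i = p \<and> j = q \<and> k = r then 1 else 0 :: real"
  have "V_inner (w i j k) (w p q r) = (1/2) * (\<Sum>a\<in>UNIV. \<Sum>b\<in>UNIV.
      (if b = j then if a = i then ?c else 0 else 0) + (if b = i then if a = j then ?c else 0 else 0))"
    unfolding V_inner_def w_def
    using assms(2-4)
    by (intro arg_cong[where f="\<lambda>x. (1/2) * x"] sum.cong refl) (auto simp: ax inner_axis_axis)
  also have "\<dots> = ?c"
    by (simp add: sum.distrib)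
  finally show ?thesis .
qed

lemma moment_map_ex1:
  fixes \<mu> :: "real^'n \<Rightarrow> real^'n \<Rightarrow> real^'n"
  assumes "\<mu> \<in> skew_bilinear_maps"
  shows "\<exists>!M. M \<in> symmetric_matrices \<and>
     (\<forall>E\<in>symmetric_matrices. trace (M ** transpose E) = V_inner (gl_action E \<mu>) \<mu> / V_inner \<mu> \<mu>)"
proof -
  have bil: "bilinear \<mu>" using assms by (simp add: skew_bilinear_maps_def)
  note bs = bilinear_ladd[OF bil] bilinear_radd[OF bil] bilinear_lmul[OF bil] bilinear_rmul[OF bil]
  define L where "L E = V_inner (gl_action E \<mu>) \<mu> / V_inner \<mu> \<mu>" for E
  have tr: "trace (M ** transpose E) = M \<bullet> E" for M E :: "real^'n^'n"
    by (simp add: trace_def matrix_matrix_mult_def transpose_def inner_vec_def)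
  have add: "gl_action (A + B) \<mu> x y = gl_action A \<mu> x y + gl_action B \<mu> x y" for A B x y
    by (simp add: gl_action_def matrix_vector_mult_add_rdistrib bs)
  have scale: "gl_action (c *\<^sub>R A) \<mu> x y = c *\<^sub>R gl_action A \<mu> x y" for c A x y
    by (simp add: gl_action_def scaleR_matrix_vector_assoc[symmetric] bs scaleR_diff_right)
  have linL: "linear L"
    by (rule linearI)
       (simp_all add: L_def V_inner_def add scale inner_add_left sum.distrib add_divide_distrib
          sum_distrib_left[symmetric] distrib_left)
  have tt: "transpose A \<bullet> transpose E = A \<bullet> E" for A E :: "real^'n^'n"
    by (simp add: inner_vec_def transpose_def) (rule sum.swap)
  obtain A where A: "\<And>E. A \<bullet> E = L E"
  proof -
    have "L E = (\<Sum>b\<in>Basis. L b *\<^sub>R b) \<bullet> E" for E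
    proof -
      have "L E = L (\<Sum>b\<in>Basis. (E \<bullet> b) *\<^sub>R b)" by (simp add: euclidean_representation)
      also have "\<dots> = (\<Sum>b\<in>Basis. (E \<bullet> b) * L b)"
        by (simp add: linear_sum[OF linL] linear_scale[OF linL])
      finally show ?thesis by (simp add: inner_sum_left inner_commute[of E] mult.commute)
    qed
    then show ?thesis using that by metis
  qed
  have trl: "transpose ((1/2) *\<^sub>R (A + transpose A)) = (1/2) *\<^sub>R (A + transpose A)"
    by (simp add: vec_eq_iff transpose_def add.commute)
  have "((1/2) *\<^sub>R (A + transpose A)) \<bullet> E = L E" if "transpose E = E" for E
    using tt[of A E] that A[of E] by (simp add: inner_add_left)
  moreover have "M = N" if "transpose M = M" "transpose N = N"
    "\<And>E. transpose E = E \<Longrightarrow> M \<bullet> E = L E" "\<And>E. transpose E = E \<Longrightarrow> N \<bullet> E = L E" for M N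
  proof -
    have "transpose (M - N) = M - N"
      using that(1,2) by (simp add: vec_eq_iff transpose_def)
    then have "(M - N) \<bullet> (M - N) = 0" using that(3,4) by (simp add: inner_diff_left)
    then show ?thesis by simp
  qed
  ultimately show ?thesis
    unfolding tr symmetric_matrices_def mem_Collect_eq L_def[symmetric] Ball_def
    using trl by (intro ex1I[of _ "(1/2) *\<^sub>R (A + transpose A)"]) auto
qed

lemma closure_in_V_iff:
  fixes S :: "(real^'n \<Rightarrow> real^'n \<Rightarrow> real^'n) set"
  assumes S: "S \<subseteq> skew_bilinear_maps"
  shows "\<mu> \<in> closure_in_V S \<longleftrightarrow> \<mu> \<in> skew_bilinear_maps \<and>
    (\<forall>\<epsilon>>0. \<exists>\<nu>\<in>S. V_inner (\<lambda>x y. \<nu> x y - \<mu> x y) (\<lambda>x y. \<nu> x y - \<mu> x y) < \<epsilon>)"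
  (is "_ \<longleftrightarrow> _ \<and> ?R")
proof -
  let ?q = "\<lambda>\<nu>. V_inner (\<lambda>x y. \<nu> x y - \<mu> x y) (\<lambda>x y. \<nu> x y - \<mu> x y)"
  have cont: "continuous_on UNIV (\<lambda>\<nu>::real^'n \<Rightarrow> real^'n \<Rightarrow> real^'n. \<nu> x y)" for x y
    by (rule continuous_on_product_then_coordinatewise[where f="\<lambda>\<nu>. \<nu> x" and i=y],
        rule continuous_on_product_then_coordinatewise[where f="\<lambda>\<nu>. \<nu>" and i=x],
        rule continuous_on_id)
  have contq: "continuous_on UNIV ?q"
    unfolding V_inner_def by (intro continuous_on_mult continuous_on_sum continuous_on_inner continuous_on_diff
        continuous_on_const cont)
  have eq: "\<mu> \<in> closure_in_V S \<longleftrightarrow> \<mu> \<in> skew_bilinear_maps \<and> \<mu> \<in> closure S"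
    using S by (auto simp: closure_in_V_def closure_of_subtopology Int_absorb1)
  have 1: ?R if "\<mu> \<in> closure S"
  proof (intro allI impI)
    fix \<epsilon> :: real assume "\<epsilon> > 0"
    have "open (?q -` {..<\<epsilon>})" using contq by (intro open_vimage) auto
    moreover have "\<mu> \<in> ?q -` {..<\<epsilon>}" using \<open>\<epsilon> > 0\<close> by (simp add: V_inner_def)
    ultimately have "?q -` {..<\<epsilon>} \<inter> S \<noteq> {}"
      using that open_Int_closure_eq_empty by blast
    then show "\<exists>\<nu>\<in>S. ?q \<nu> < \<epsilon>" by auto
  qed
  have 2: "\<mu> \<in> closure S" if R: ?R and \<mu>: "\<mu> \<in> skew_bilinear_maps"
  proof -
    have "\<exists>\<nu>. \<nu> \<in> S \<and> ?q \<nu> < inverse (real (Suc n))" for n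
      using R[rule_format, of "inverse (real (Suc n))"] by auto
    then have "\<forall>n. \<exists>\<nu>. \<nu> \<in> S \<and> ?q \<nu> < inverse (real (Suc n))" by blast
    from choice[OF this] obtain \<nu> where "\<forall>n. \<nu> n \<in> S \<and> ?q (\<nu> n) < inverse (real (Suc n))" ..
    then have \<nu>: "\<nu> n \<in> S" "?q (\<nu> n) < inverse (real (Suc n))" for n by simp_all
    have b1: "bilinear (\<nu> n)" and b2: "bilinear \<mu>" for n
      using subsetD[OF S \<nu>(1)[of n]] \<mu> by (simp_all add: skew_bilinear_maps_def)
    let ?d = "\<lambda>n x y. \<nu> n x y - \<mu> x y"
    have entry: "a i j \<le> (\<Sum>i\<in>UNIV. \<Sum>j\<in>UNIV. a i j)"
      if "\<And>i j. a i j \<ge> 0" for a :: "'n \<Rightarrow> 'n \<Rightarrow> real" and i j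
    proof -
      have "a i j \<le> (\<Sum>j\<in>UNIV. a i j)"
        by (rule member_le_sum) (use that in auto)
      also have "\<dots> \<le> (\<Sum>i\<in>UNIV. \<Sum>j\<in>UNIV. a i j)"
        by (rule member_le_sum[where f="\<lambda>i. \<Sum>j\<in>UNIV. a i j"]) (use that in \<open>auto intro: sum_nonneg\<close>)
      finally show ?thesis .
    qed
    have q_ge: "?d n (axis i 1) (axis j 1) \<bullet> ?d n (axis i 1) (axis j 1) \<le> 2 * ?q (\<nu> n)" for n i j
      using entry[of "\<lambda>i j. ?d n (axis i 1) (axis j 1) \<bullet> ?d n (axis i 1) (axis j 1)" i j]
      by (simp add: V_inner_def)
    have q_nonneg: "?q \<nu> \<ge> 0" for \<nu>
      by (simp add: V_inner_def sum_nonneg)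
    have "(\<lambda>n. ?q (\<nu> n)) \<longlonglongrightarrow> 0"
      by (rule tendsto_sandwich[OF _ _ tendsto_const LIMSEQ_inverse_real_of_nat];
          rule always_eventually, rule allI, rule q_nonneg less_imp_le[OF \<nu>(2)])
    then have q0: "(\<lambda>n. 2 * ?q (\<nu> n)) \<longlonglongrightarrow> 0"
      using tendsto_mult_right_zero by blast
    have d0: "(\<lambda>n. ?d n (axis i 1) (axis j 1)) \<longlonglongrightarrow> 0" for i j
    proof -
      have "(\<lambda>n. (norm (?d n (axis i 1) (axis j 1)))\<^sup>2) \<longlonglongrightarrow> 0"
        unfolding power2_norm_eq_inner
        by (rule tendsto_sandwich[OF _ _ tendsto_const q0];
            rule always_eventually, rule allI, rule inner_ge_zero q_ge)
      then have "(\<lambda>n. norm (?d n (axis i 1) (axis j 1))) \<longlonglongrightarrow> 0"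
        by (auto dest: tendsto_real_sqrt)
      then show ?thesis by (rule tendsto_norm_zero_cancel)
    qed
    have expand: "?d n x y = (\<Sum>i\<in>UNIV. \<Sum>j\<in>UNIV. (x $ i * y $ j) *\<^sub>R ?d n (axis i 1) (axis j 1))" for n x y
    proof -
      have rep: "(\<Sum>i\<in>UNIV. (x $ i) *\<^sub>R axis i 1) = x" for x :: "real^'n"
        using basis_expansion[of x] by (simp add: scalar_mult_eq_scaleR)
      have ll: "linear (\<lambda>x. ?d n x y)" and lr: "linear (?d n x)" for x y
        using b1[of n] b2 by (simp_all add: bilinear_def linear_compose_sub)
      have "?d n x y = ?d n (\<Sum>i\<in>UNIV. (x $ i) *\<^sub>R axis i 1) y"
        by (simp only: rep)
      also have "\<dots> = (\<Sum>i\<in>UNIV. (x $ i) *\<^sub>R ?d n (axis i 1) y)"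
        by (simp only: linear_sum[OF ll] linear_scale[OF ll])
      also have "\<dots> = (\<Sum>i\<in>UNIV. (x $ i) *\<^sub>R ?d n (axis i 1) (\<Sum>j\<in>UNIV. (y $ j) *\<^sub>R axis j 1))"
        by (simp only: rep)
      also have "\<dots> = (\<Sum>i\<in>UNIV. (x $ i) *\<^sub>R (\<Sum>j\<in>UNIV. (y $ j) *\<^sub>R ?d n (axis i 1) (axis j 1)))"
        by (simp only: linear_sum[OF lr] linear_scale[OF lr])
      finally show ?thesis by (simp only: scaleR_sum_right scaleR_scaleR)
    qed
    have "(\<lambda>n. \<nu> n x y) \<longlonglongrightarrow> \<mu> x y" for x y
    proof -
      have "(\<lambda>n. \<Sum>i\<in>UNIV. \<Sum>j\<in>UNIV. (x $ i * y $ j) *\<^sub>R ?d n (axis i 1) (axis j 1)) \<longlonglongrightarrow>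
            (\<Sum>i\<in>UNIV. \<Sum>j\<in>UNIV. (x $ i * y $ j) *\<^sub>R 0)"
        by (intro tendsto_sum tendsto_scaleR tendsto_const d0)
      then have "(\<lambda>n. ?d n x y) \<longlonglongrightarrow> 0" unfolding expand[symmetric] by simp
      then show ?thesis by (simp add: LIM_zero_iff)
    qed
    then have "\<nu> \<longlonglongrightarrow> \<mu>"
      by (simp flip: limitin_canonical_iff euclidean_product_topology
               add: limitin_componentwise)
    then show ?thesis using \<nu>(1) by (intro Lim_in_closed_set[of "closure S" \<nu> sequentially])
      (auto intro!: always_eventually subsetD[OF closure_subset])
  qed
  show ?thesis using eq 1 2 by blast
qed

end

theory Submission
  imports Defs
begin

text \<open>
  A metric for which \<open>D\<close> is symmetric and \<open>f \<perp> \<nn>\<close> is, up to an element \<open>h\<close> of \<open>G_D\<close>, the standard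
  one for the bracket \<open>h \<cdot> [\<cdot>, \<cdot>]\<close> with \<open>|f|\<^sup>2 = c\<close> free: the Gram matrix commutes with \<open>D\<close>, so it
  has a root in \<open>G_D\<close>. Since \<open>D\<close> is symmetric and \<open>\<nn>\<close> nilpotent, the Ricci operator is
  \<open>M / 2 - (tr D / c) D\<close> on \<open>\<nn>\<close> and \<open>- tr D\<^sup>2 / c\<close> on \<open>f\<close>, where \<open>M\<close> is a positive multiple of the
  moment map at \<open>h \<cdot> [\<cdot>, \<cdot>]\<close>. Hence \<open>D\<close> is Ricci negative iff \<open>D - r M\<close> is positive definite for
  some \<open>h\<close> and \<open>r > 0\<close>. As \<open>M\<close> commutes with \<open>D\<close>, an orthogonal element of \<open>G_D\<close> moves it into any
  given Weyl chamber, which yields (ii)--(iv). Conversely, positive definiteness is an open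
  condition, so it passes from a point of the orbit closure to nearby points of the orbit; no
  convexity of the moment map is needed.
\<close>

section \<open>Traces of nilpotent endomorphisms\<close>

text \<open>The delicate point is that \<open>G_group D\<close> is the identity component and not
  the whole centralizer, so every matrix that is constructed must be joined to 1. A spectral theorem
  followed by a permutation of the basis would not guarantee this. Diagonalization is therefore done
  by maximising over the component of 1 in the orthogonal centralizer of D, and the root of a Gram
  matrix is a product L U with L positive diagonal and U such a maximiser. The constants match as
  follows: multiplying M / 2 - (tr D / c) D by - c / tr D gives D - (c / (2 tr D)) M, so r = c / (2
  tr D), and c ranges over all positive numbers. The direction of f imposes nothing, since tr D > 0
  already forces tr D^2 > 0. At an orbit point close to a point of the closure, M may fail to be
  diagonal. It still commutes with D, because D is a derivation of every bracket in the orbit; this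
  is what leads from mere positive definiteness back into a chamber.\<close>

lemma endo_trace_commute:
  fixes S :: "'b::euclidean_space \<Rightarrow> 'a::euclidean_space" and T :: "'a \<Rightarrow> 'b"
  assumes S: "linear S" and T: "linear T"
  shows "endo_trace (\<lambda>x. S (T x)) = endo_trace (\<lambda>x. T (S x))"
proof -
  have exp: "F v \<bullet> u = (\<Sum>c\<in>Basis. (v \<bullet> c) * (F c \<bullet> u))" if "linear F"
    for F :: "'c::euclidean_space \<Rightarrow> 'd::euclidean_space" and u v
  proof -
    have "F v = F (\<Sum>c\<in>Basis. (v \<bullet> c) *\<^sub>R c)" by (simp add: euclidean_representation)
    also have "\<dots> = (\<Sum>c\<in>Basis. (v \<bullet> c) *\<^sub>R F c)"
      by (simp add: linear_sum[OF that] linear_scale[OF that])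
    finally show ?thesis by (simp add: inner_sum_left)
  qed
  have "endo_trace (\<lambda>x. S (T x)) = (\<Sum>b\<in>Basis. \<Sum>c\<in>Basis. (T b \<bullet> c) * (S c \<bullet> b))"
    unfolding endo_trace_def by (intro sum.cong refl exp[OF S])
  also have "\<dots> = (\<Sum>c\<in>Basis. \<Sum>b\<in>Basis. (S c \<bullet> b) * (T b \<bullet> c))"
    by (subst sum.swap) (simp add: mult.commute)
  also have "\<dots> = endo_trace (\<lambda>x. T (S x))"
    unfolding endo_trace_def by (intro sum.cong refl exp[OF T, symmetric])
  finally show ?thesis .
qed

text \<open>Let p_k be a projection onto C k. Since T maps C k into C (k+1), T p_k = p_{k+1} T p_k,
  and cyclicity of the trace turns this into T p_k p_{k+1} = T p_{k+1}. The trace of T p_k is thus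
  the same for all k; it is tr T at k = 0 and 0 at k = m. No basis adapted to the flag is
  chosen.\<close>

lemma endo_trace_nilpotent:
  fixes T :: "'a::euclidean_space \<Rightarrow> 'a"
  assumes T: "linear T" and sub: "\<And>k. subspace (C k)" and dec: "\<And>k. C (Suc k) \<subseteq> C k"
    and shift: "\<And>k x. x \<in> C k \<Longrightarrow> T x \<in> C (Suc k)" and top: "C 0 = UNIV" and bot: "C m = {0}"
  shows "endo_trace T = 0"
proof -
  \<comment> \<open>A linear left inverse of the identity on C k, with range in C k, is a projection
    onto C k.\<close>
  have "\<exists>p. range p \<subseteq> C k \<and> linear p \<and> (\<forall>v\<in>C k. p v = v)" for k
    using linear_exists_left_inverse_on[OF linear_id sub[of k]] by auto
  then obtain p where p: "\<And>k x. p k x \<in> C k" "\<And>k. linear (p k)" "\<And>k v. v \<in> C k \<Longrightarrow> p k v = v"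
    by (metis rangeI subset_iff)
  have "endo_trace (\<lambda>x. T (p k x)) = endo_trace T" for k
  proof (induction k)
    case 0
    then show ?case by (simp add: p(3) top)
  next
    case (Suc k)
    have "endo_trace (\<lambda>x. T (p k x)) = endo_trace (\<lambda>x. p (Suc k) (T (p k x)))"
      by (simp add: p(1,3) shift)
    also have "\<dots> = endo_trace (\<lambda>x. T (p k (p (Suc k) x)))"
      using endo_trace_commute[OF p(2)[of "Suc k"] linear_compose[OF p(2)[of k] T]] by simp
    also have "\<dots> = endo_trace (\<lambda>x. T (p (Suc k) x))"
      using p(1)[of "Suc k"] dec[of k] by (simp add: p(3) subset_iff)
    finally show ?case using Suc by simp
  qed
  from this[of m] have "endo_trace T = endo_trace (\<lambda>x. T (p m x))" by simp
  also have "\<dots> = 0" using p(1)[of m] bot linear_0[OF T] by (simp add: endo_trace_def)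
  finally show ?thesis .
qed

section \<open>Ricci curvature in an orthonormal basis\<close>

lemma is_inner_product_inner: "is_inner_product (inner :: 'a::euclidean_space \<Rightarrow> 'a \<Rightarrow> real)"
  unfolding is_inner_product_def
  using bounded_bilinear_inner bilinear_conv_bounded_bilinear[of "inner :: 'a \<Rightarrow> 'a \<Rightarrow> real"]
  by (simp add: inner_commute)

lemma levi_civita_props:
  fixes br :: "'a::euclidean_space \<Rightarrow> 'a \<Rightarrow> 'a"
  assumes "lie_algebra br" and "is_inner_product g"
  shows "bilinear (levi_civita br g)"
    and "levi_civita br g X Y - levi_civita br g Y X = br X Y"
    and "g (levi_civita br g X Y) Z + g Y (levi_civita br g X Z) = 0"
  using theI'[OF levi_civita_ex1[OF assms], folded levi_civita_def] by simp_all

lemma levi_civita_unique: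
  fixes br :: "'a::euclidean_space \<Rightarrow> 'a \<Rightarrow> 'a"
  assumes "lie_algebra br" and "is_inner_product g"
    and "bilinear N" and "\<And>X Y. N X Y - N Y X = br X Y"
    and "\<And>X Y Z. g (N X Y) Z + g Y (N X Z) = 0"
  shows "levi_civita br g = N"
  unfolding levi_civita_def
  by (rule the1_equality[OF levi_civita_ex1[OF assms(1,2)]]) (intro conjI allI assms(3-5))

lemma lie_algebra_antisym: "lie_algebra br \<Longrightarrow> br y x = - br x y"
proof -
  assume l: "lie_algebra br"
  then have b: "bilinear br" and alt: "\<And>x. br x x = 0" by (auto simp: lie_algebra_def)
  have "br (x + y) (x + y) = br x x + br x y + (br y x + br y y)"
    by (simp only: bilinear_ladd[OF b] bilinear_radd[OF b] add_ac)
  then show ?thesis by (simp add: alt add_eq_0_iff)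
qed

lemma koszul:
  fixes br :: "'a::euclidean_space \<Rightarrow> 'a \<Rightarrow> 'a"
  assumes l: "lie_algebra br"
  shows "levi_civita br inner X Y \<bullet> Z = (br X Y \<bullet> Z - br Y Z \<bullet> X + br Z X \<bullet> Y) / 2"
proof -
  let ?N = "levi_civita br inner"
  have m: "?N A B \<bullet> C = - (?N A C \<bullet> B)" for A B C
    using levi_civita_props(3)[OF l is_inner_product_inner, of A B C]
    by (simp add: inner_commute add_eq_0_iff)
  have t: "br A B = ?N A B - ?N B A" for A B
    using levi_civita_props(2)[OF l is_inner_product_inner, of A B] by simp
  show ?thesis
    using m[of X Y Z] m[of Y Z X] m[of Z X Y] by (simp add: t inner_diff_left)
qed

text \<open>This is the classical formula with mean curvature vector H. Its Killing form term and
  its term in the |[X, e_i]|^2 are merged: with a the matrix of ad X, the sum of (a_ij + a_ji)^2 / 4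
  is half of |ad X|^2 plus half of tr (ad X)^2.\<close>

lemma ricci_curvature_inner:
  fixes br :: "'a::euclidean_space \<Rightarrow> 'a \<Rightarrow> 'a"
  assumes l: "lie_algebra br" and H: "\<And>Y. H \<bullet> Y = endo_trace (br Y)"
  shows "ricci_curvature br inner X X = - (br H X \<bullet> X)
     + (\<Sum>i\<in>Basis. \<Sum>j\<in>Basis. (br i j \<bullet> X)\<^sup>2) / 4
     - (\<Sum>i\<in>Basis. \<Sum>j\<in>Basis. (br X i \<bullet> j + br X j \<bullet> i)\<^sup>2) / 4"
proof -
  let ?N = "levi_civita br inner"
  note ko = koszul[OF l] and anti = lie_algebra_antisym[OF l]
  have alt: "\<And>x. br x x = 0" using l by (auto simp: lie_algebra_def)
  have bN: "bilinear ?N" by (rule levi_civita_props(1)[OF l is_inner_product_inner])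
  have m: "?N A B \<bullet> C = - (?N A C \<bullet> B)" for A B C
    using levi_civita_props(3)[OF l is_inner_product_inner, of A B C]
    by (simp add: inner_commute add_eq_0_iff)
  define n where "n i j = ?N i X \<bullet> j" for i j
  define a where "a i j = br X i \<bullet> j" for i j
  define J where "J i j = br j i \<bullet> X" for i j
  \<comment> \<open>The Koszul formula splits the matrix of \<open>nabla X\<close> into a skew part
    J / 2 and a symmetric part, which is minus the symmetrisation of ad X.\<close>
  have n: "n i j = (J i j - (a i j + a j i)) / 2" for i j
    unfolding n_def a_def J_def ko using anti[of X i] by simp
  have J: "J j i = - J i j" for i j
    unfolding J_def using anti[of i j] by simp
  have exp: "u \<bullet> v = (\<Sum>j\<in>Basis. (u \<bullet> j) * (v \<bullet> j))" for u v :: 'a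
    by (rule euclidean_inner)
  have 1: "(\<Sum>i\<in>Basis. ?N i (?N X X) \<bullet> i) = - (br H X \<bullet> X)"
  proof -
    have "(\<Sum>i\<in>Basis. ?N i (?N X X) \<bullet> i) = - (\<Sum>i\<in>Basis. br (?N X X) i \<bullet> i)"
      unfolding sum_negf[symmetric]
    proof (rule sum.cong[OF refl])
      fix i :: 'a
      have "?N i (?N X X) \<bullet> i = (br i (?N X X) \<bullet> i - br (?N X X) i \<bullet> i + br i i \<bullet> ?N X X) / 2"
        by (rule ko)
      then show "?N i (?N X X) \<bullet> i = - (br (?N X X) i \<bullet> i)"
        using anti[of "?N X X" i] alt by simp
    qed
    also have "\<dots> = - (?N X X \<bullet> H)" using H[of "?N X X"] by (simp add: endo_trace_def inner_commute)
    also have "?N X X \<bullet> H = br H X \<bullet> X"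
      using anti[of X H] by (simp add: ko alt)
    finally show ?thesis .
  qed
  have 2: "- (?N X (?N i X) \<bullet> i) = (\<Sum>j\<in>Basis. n i j * (n i j + a i j))" for i
  proof -
    have "- (?N X (?N i X) \<bullet> i) = ?N i X \<bullet> ?N X i"
      using m[of X "?N i X" i] by (simp add: inner_commute)
    also have "?N X i = ?N i X + br X i"
      using levi_civita_props(2)[OF l is_inner_product_inner, of X i] by (simp add: algebra_simps)
    finally show ?thesis
      by (subst (asm) exp) (simp add: inner_add_left n_def a_def)
  qed
  have 3: "- (?N (br i X) X \<bullet> i) = (\<Sum>j\<in>Basis. a i j * n j i)" for i
  proof -
    have lin: "linear (\<lambda>v. ?N v X)" using bN by (simp add: bilinear_def)
    have "- (?N (br i X) X \<bullet> i) = ?N (br X i) X \<bullet> i"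
      using anti[of X i] bilinear_lneg[OF bN] by simp
    also have "br X i = (\<Sum>j\<in>Basis. (br X i \<bullet> j) *\<^sub>R j)" by (simp add: euclidean_representation)
    finally show ?thesis
      by (simp add: linear_sum[OF lin] linear_scale[OF lin] inner_sum_left n_def a_def)
  qed
  \<comment> \<open>Here z, p, q stand for \<open>J i j\<close>, \<open>a i j\<close>,
    \<open>a j i\<close>. The summand \<open>f i j\<close> becomes a difference of squares only
    after averaging over the exchange of i and j.\<close>
  have alg: "((z - (p + q)) / 2 * ((z - (p + q)) / 2 + p) + p * ((- z - (q + p)) / 2) +
      ((- z - (q + p)) / 2 * ((- z - (q + p)) / 2 + q) + q * ((z - (p + q)) / 2))) / 2
      = (- z)\<^sup>2 / 4 - (p + q)\<^sup>2 / 4" for p q z :: real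
    by (simp add: field_simps power2_eq_square)
  define f where "f i j = n i j * (n i j + a i j) + a i j * n j i" for i j
  have "ricci_curvature br inner X X =
      (\<Sum>i\<in>Basis. ?N i (?N X X) \<bullet> i + (- (?N X (?N i X) \<bullet> i)) + (- (?N (br i X) X \<bullet> i)))"
    by (simp add: ricci_curvature_def endo_trace_def riemann_curvature_def Let_def inner_diff_left
        algebra_simps)
  also have "\<dots> = - (br H X \<bullet> X) + (\<Sum>i\<in>Basis. \<Sum>j\<in>Basis. f i j)"
    unfolding 2 3 by (simp add: sum.distrib 1 f_def)
  also have "(\<Sum>i\<in>Basis. \<Sum>j\<in>Basis. f i j) = (\<Sum>i\<in>Basis. \<Sum>j\<in>Basis. (f i j + f j i) / 2)"
  proof -
    have "(\<Sum>i\<in>Basis. \<Sum>j\<in>Basis. f i j) = (\<Sum>i\<in>Basis. \<Sum>j\<in>Basis. f j i)" by (rule sum.swap)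
    then show ?thesis by (simp add: sum.distrib sum_divide_distrib[symmetric])
  qed
  also have "\<dots> = (\<Sum>i\<in>Basis. \<Sum>j\<in>Basis. (J j i)\<^sup>2 / 4 - (a i j + a j i)\<^sup>2 / 4)"
  proof (intro sum.cong refl)
    fix i j :: 'a
    show "(f i j + f j i) / 2 = (J j i)\<^sup>2 / 4 - (a i j + a j i)\<^sup>2 / 4"
      unfolding f_def n J[of j i] by (rule alg)
  qed
  finally show ?thesis
    by (simp add: J_def a_def sum_subtractf sum_divide_distrib)
qed

text \<open>Pulling the connection of \<open>g'\<close> back along T yields a torsion-free metric
  connection for \<open>g\<close>, which by uniqueness is the Levi-Civita connection. The curvatures
  are then conjugate by T, and cyclicity of the trace across the two spaces removes the
  conjugation.\<close>

lemma ricci_curvature_isometry: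
  fixes br :: "'a::euclidean_space \<Rightarrow> 'a \<Rightarrow> 'a" and br' :: "'b::euclidean_space \<Rightarrow> 'b \<Rightarrow> 'b"
  assumes l: "lie_algebra br" and l': "lie_algebra br'"
    and g: "is_inner_product g" and g': "is_inner_product g'"
    and T: "linear T" and T': "linear T'" and TT': "\<And>x. T (T' x) = x" and T'T: "\<And>x. T' (T x) = x"
    and hom: "\<And>x y. T (br x y) = br' (T x) (T y)" and iso: "\<And>x y. g x y = g' (T x) (T y)"
  shows "ricci_curvature br g X Y = ricci_curvature br' g' (T X) (T Y)"
proof -
  let ?N = "levi_civita br' g'"
  note p = levi_civita_props[OF l' g']
  have b': "bilinear br'" using l' by (simp add: lie_algebra_def)
  have lc: "levi_civita br g = (\<lambda>x y. T' (?N (T x) (T y)))"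
  proof (rule levi_civita_unique[OF l g])
    show "bilinear (\<lambda>x y. T' (?N (T x) (T y)))"
      unfolding bilinear_def
      by (intro conjI allI linearI)
         (simp_all add: linear_add[OF T] linear_scale[OF T] linear_add[OF T'] linear_scale[OF T']
           bilinear_ladd[OF p(1)] bilinear_radd[OF p(1)] bilinear_lmul[OF p(1)] bilinear_rmul[OF p(1)])
    show "T' (?N (T x) (T y)) - T' (?N (T y) (T x)) = br x y" for x y
      by (simp add: linear_diff[OF T', symmetric] p(2) hom[symmetric] T'T)
    show "g (T' (?N (T x) (T y))) z + g y (T' (?N (T x) (T z))) = 0" for x y z
      by (simp add: iso TT' p(3))
  qed
  have R: "riemann_curvature br g x y z = T' (riemann_curvature br' g' (T x) (T y) (T z))" for x y z
    by (simp add: riemann_curvature_def Let_def lc TT' hom linear_diff[OF T'])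
  let ?F = "\<lambda>z. riemann_curvature br' g' z (T X) (T Y)"
  have F: "linear ?F"
    by (rule linearI)
       (simp_all add: riemann_curvature_def Let_def scaleR_diff_right
         bilinear_ladd[OF p(1)] bilinear_radd[OF p(1)] bilinear_lmul[OF p(1)] bilinear_rmul[OF p(1)]
         bilinear_ladd[OF b'] bilinear_lmul[OF b'])
  have "ricci_curvature br g X Y = endo_trace (\<lambda>z. T' (?F (T z)))"
    by (simp add: ricci_curvature_def R)
  also have "\<dots> = endo_trace (\<lambda>z. ?F (T (T' z)))"
    using endo_trace_commute[OF T' linear_compose[OF T F]] by simp
  finally show ?thesis by (simp add: ricci_curvature_def TT')
qed

section \<open>Matrices\<close>

lemma transpose_diagonal: "D \<in> diagonal_matrices \<Longrightarrow> transpose D = D"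
  unfolding vec_eq_iff transpose_def diagonal_matrices_def vec_lambda_beta mem_Collect_eq by metis

lemma diagonal_matrix_vector_component:
  fixes D :: "real^'n^'n"
  assumes "D \<in> diagonal_matrices"
  shows "(D *v x) $ i = D $ i $ i * x $ i"
proof -
  have "(D *v x) $ i = (\<Sum>j\<in>UNIV. if j = i then D $ i $ i * x $ i else 0)"
    unfolding matrix_vector_mult_def vec_lambda_beta
    by (rule sum.cong) (use assms in \<open>auto simp: diagonal_matrices_def\<close>)
  then show ?thesis by simp
qed

lemma diagonal_matrix_vector_axis:
  fixes D :: "real^'n^'n"
  assumes "D \<in> diagonal_matrices"
  shows "D *v axis i 1 = D $ i $ i *\<^sub>R axis i 1"
  by (simp add: vec_eq_iff diagonal_matrix_vector_component[OF assms]) (simp add: axis_def)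

lemma inner_matrix_vector_axis: "axis a 1 \<bullet> (A *v axis b 1) = A $ a $ b"
  for A :: "real^'n^'n"
  by (simp add: inner_axis' matrix_vector_mul_component inner_axis)

lemma inner_matrix_vector_transpose: "(B *v v) \<bullet> x = v \<bullet> (transpose B *v x)"
  for B :: "real^'n^'n"
  by (simp add: dot_lmul_matrix[symmetric] inner_commute)

lemma orthogonal_matrix_norm_row:
  fixes U :: "real^'n^'n"
  shows "orthogonal_matrix U \<Longrightarrow> norm (U $ i) = 1"
  by (simp add: orthogonal_matrix_orthonormal_rows row_def vec_nth_inverse)

lemma matrix_mult_diagonal_left:
  fixes D :: "real^'n^'n"
  assumes "D \<in> diagonal_matrices"
  shows "(D ** U) $ k $ l = D $ k $ k * U $ k $ l"
proof -
  have "(D ** U) $ k $ l = (\<Sum>m\<in>UNIV. if m = k then D $ k $ k * U $ k $ l else 0)"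
    unfolding matrix_matrix_mult_def vec_lambda_beta
    by (rule sum.cong) (use assms in \<open>auto simp: diagonal_matrices_def\<close>)
  then show ?thesis by simp
qed

lemma matrix_mult_diagonal_right:
  fixes D :: "real^'n^'n"
  assumes "D \<in> diagonal_matrices"
  shows "(U ** D) $ k $ l = U $ k $ l * D $ l $ l"
proof -
  have "(U ** D) $ k $ l = (\<Sum>m\<in>UNIV. if m = l then U $ k $ l * D $ l $ l else 0)"
    unfolding matrix_matrix_mult_def vec_lambda_beta
    by (rule sum.cong) (use assms in \<open>auto simp: diagonal_matrices_def\<close>)
  then show ?thesis by simp
qed

lemma commute_diagonal_iff:
  fixes D :: "real^'n^'n"
  assumes "D \<in> diagonal_matrices"
  shows "U ** D = D ** U \<longleftrightarrow> (\<forall>k l. D $ k $ k \<noteq> D $ l $ l \<longrightarrow> U $ k $ l = 0)"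
proof -
  have "U ** D = D ** U \<longleftrightarrow> (\<forall>k l. U $ k $ l * D $ l $ l = D $ k $ k * U $ k $ l)"
    by (simp add: vec_eq_iff matrix_mult_diagonal_left[OF assms] matrix_mult_diagonal_right[OF assms])
  also have "\<dots> \<longleftrightarrow> (\<forall>k l. D $ k $ k \<noteq> D $ l $ l \<longrightarrow> U $ k $ l = 0)"
    by (auto simp: mult.commute) metis
  finally show ?thesis .
qed

lemma commute_mult:
  fixes A B D :: "real^'n^'n"
  assumes A: "A ** D = D ** A" and B: "B ** D = D ** B"
  shows "A ** B ** D = D ** (A ** B)"
proof -
  have "A ** B ** D = A ** (B ** D)" by (simp add: matrix_mul_assoc)
  also have "\<dots> = A ** D ** B" unfolding B by (simp add: matrix_mul_assoc)
  also have "\<dots> = D ** (A ** B)" unfolding A by (simp add: matrix_mul_assoc)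
  finally show ?thesis .
qed

section \<open>Ricci curvature of the semidirect sum\<close>

lemma lie_algebra_transport:
  fixes br :: "'a::euclidean_space \<Rightarrow> 'a \<Rightarrow> 'a" and T :: "'a \<Rightarrow> 'b::euclidean_space"
  assumes l: "lie_algebra br" and T: "linear T" and T': "linear T'"
    and T'T: "\<And>x. T' (T x) = x"
  shows "lie_algebra (\<lambda>x y. T (br (T' x) (T' y)))"
proof -
  have b: "bilinear br" and alt: "\<And>x. br x x = 0"
    and jac: "\<And>x y z. br x (br y z) + br y (br z x) + br z (br x y) = 0"
    using l by (auto simp: lie_algebra_def)
  have "T (br x (br y z)) + T (br y (br z x)) + T (br z (br x y)) = 0" for x y z
    by (simp only: linear_add[OF T, symmetric] jac linear_0[OF T])
  then show ?thesis
    unfolding lie_algebra_def bilinear_def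
    by (intro conjI allI linearI)
       (simp_all add: T'T alt linear_add[OF T] linear_scale[OF T] linear_add[OF T'] linear_scale[OF T']
         linear_0[OF T]
         bilinear_ladd[OF b] bilinear_radd[OF b] bilinear_lmul[OF b] bilinear_rmul[OF b])
qed

lemma lower_central_series_transport:
  fixes br :: "'a::euclidean_space \<Rightarrow> 'a \<Rightarrow> 'a" and T :: "'a \<Rightarrow> 'b::euclidean_space"
  assumes T: "linear T" and TT': "\<And>x. T (T' x) = x" and T'T: "\<And>x. T' (T x) = x"
  shows "lower_central_series (\<lambda>x y. T (br (T' x) (T' y))) k = T ` lower_central_series br k"
proof (induction k)
  case 0
  show ?case by simp (metis TT' surjI)
next
  case (Suc k)
  have "{T (br (T' x) (T' y)) |x y. y \<in> T ` lower_central_series br k}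
      = T ` {br x y |x y. y \<in> lower_central_series br k}"
    by (auto simp: T'T image_iff) (metis T'T)+
  then show ?case by (simp add: Suc linear_span_image[OF T])
qed

lemma nilpotent_lie_algebra_transport:
  fixes br :: "'a::euclidean_space \<Rightarrow> 'a \<Rightarrow> 'a" and T :: "'a \<Rightarrow> 'b::euclidean_space"
  assumes "nilpotent_lie_algebra br" and T: "linear T" and T': "linear T'"
    and TT': "\<And>x. T (T' x) = x" and T'T: "\<And>x. T' (T x) = x"
  shows "nilpotent_lie_algebra (\<lambda>x y. T (br (T' x) (T' y)))"
proof -
  obtain k where "lie_algebra br" "lower_central_series br k = {0}"
    using assms(1) by (auto simp: nilpotent_lie_algebra_def)
  then show ?thesis
    unfolding nilpotent_lie_algebra_def
    using lie_algebra_transport[OF _ T T' T'T] lower_central_series_transport[OF T TT' T'T, of br k]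
    by (auto simp: linear_0[OF T] intro!: exI[of _ k])
qed

section \<open>The lower central series and the traces that vanish because of it\<close>

lemma subspace_lower_central_series: "subspace (lower_central_series br k)"
  by (cases k) (auto simp: subspace_span)

lemma lower_central_series_decreasing:
  "lower_central_series br (Suc k) \<subseteq> lower_central_series br k"
proof (induction k)
  case 0
  show ?case by simp
next
  case (Suc k)
  have "{br x y |x y. y \<in> lower_central_series br (Suc k)} \<subseteq> {br x y |x y. y \<in> lower_central_series br k}"
    using Suc by blast
  then show ?case unfolding lower_central_series.simps(2) by (intro span_mono)
qed

lemma bracket_in_lower_central_series:
  "y \<in> lower_central_series br k \<Longrightarrow> br x y \<in> lower_central_series br (Suc k)"
  by (auto intro: span_base)

text \<open>The Leibniz rule sends a generator [p, q] to [A p, q] + [p, A q]; in the second term the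
  induction hypothesis keeps A q in the previous step of the series.\<close>

lemma derivation_lower_central_series:
  assumes A: "A \<in> Der br" and x: "x \<in> lower_central_series br k"
  shows "A *v x \<in> lower_central_series br k"
  using x
proof (induction k arbitrary: x)
  case 0
  show ?case by simp
next
  case (Suc k)
  let ?S = "{br x y |x y. y \<in> lower_central_series br k}"
  have "A *v u \<in> span ?S" if uS: "u \<in> ?S" for u
  proof -
    obtain p q where u: "u = br p q" and q: "q \<in> lower_central_series br k" using uS by blast
    have "A *v u = br (A *v p) q + br p (A *v q)" using A by (simp add: u Der_def)
    moreover have "br (A *v p) q \<in> span ?S" "br p (A *v q) \<in> span ?S"
      using q Suc.IH[OF q] by (auto intro!: span_base)
    ultimately show ?thesis by (simp add: span_add)
  qed
  then have "(*v) A ` ?S \<subseteq> span ?S" by blast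
  then have "(*v) A ` span ?S \<subseteq> span ?S"
    by (simp add: linear_span_image[symmetric] span_minimal)
  then show ?case using Suc.prems by auto
qed

text \<open>Each of the three maps pushes the lower central series down by at least one step. In the
  Ricci curvature of the semidirect sum these traces are the mean curvature along the nilpotent
  part, its Killing form, and the mixed term between f and the nilpotent part.\<close>

lemma nilpotent_lie_algebra_traces:
  fixes br :: "real^'n \<Rightarrow> real^'n \<Rightarrow> real^'n"
  assumes nil: "nilpotent_lie_algebra br"
  shows "endo_trace (br x) = 0"
    and "endo_trace (\<lambda>y. br x (br x y)) = 0"
    and "A \<in> Der br \<Longrightarrow> endo_trace (\<lambda>y. A *v br x y) = 0"
proof -
  obtain m where l: "lie_algebra br" and m: "lower_central_series br m = {0}"
    using nil by (auto simp: nilpotent_lie_algebra_def)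
  have lin: "linear (br x)" using l by (auto simp: lie_algebra_def bilinear_def)
  note tr = endo_trace_nilpotent[where C="lower_central_series br",
      OF _ subspace_lower_central_series lower_central_series_decreasing _ lower_central_series.simps(1) m]
  note step = bracket_in_lower_central_series[of _ br _ x]
  show "endo_trace (br x) = 0"
    by (rule tr[OF lin step])
  show "endo_trace (\<lambda>y. br x (br x y)) = 0"
    by (rule tr[OF linear_compose[OF lin lin, unfolded o_def]])
       (blast intro: step subsetD[OF lower_central_series_decreasing])
  show "endo_trace (\<lambda>y. A *v br x y) = 0" if "A \<in> Der br"
    by (rule tr[OF linear_compose[OF lin matrix_vector_mul_linear[of A], unfolded o_def]])
       (blast intro: step derivation_lower_central_series[OF that])
qed

lemma lie_algebra_semidirect:
  assumes l: "lie_algebra br" and A: "A \<in> Der br"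
  shows "lie_algebra (semidirect_bracket br A)"
proof -
  have b: "bilinear br" and alt: "\<And>x. br x x = 0"
    and jac: "\<And>x y z. br x (br y z) + br y (br z x) + br z (br x y) = 0"
    using l by (auto simp: lie_algebra_def)
  note bs = bilinear_ladd[OF b] bilinear_radd[OF b] bilinear_lmul[OF b] bilinear_rmul[OF b]
    bilinear_lsub[OF b] bilinear_rsub[OF b]
  note ms = matrix_vector_right_distrib matrix_vector_mult_scaleR matrix_vector_mult_diff_distrib
  have D: "A *v br x y = br (A *v x) y + br x (A *v y)" for x y using A by (simp add: Der_def)
  have bil: "bilinear (semidirect_bracket br A)"
    unfolding bilinear_def
    by (intro conjI allI linearI; clarsimp simp: semidirect_bracket_def bs ms algebra_simps)
  have jac': "semidirect_bracket br A X (semidirect_bracket br A Y Z)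
      + semidirect_bracket br A Y (semidirect_bracket br A Z X)
      + semidirect_bracket br A Z (semidirect_bracket br A X Y) = 0" for X Y Z
  proof -
    obtain a x b y c z where "X = (a, x)" "Y = (b, y)" "Z = (c, z)" by (metis prod.exhaust)
    then show ?thesis
      using jac[of x y z] lie_algebra_antisym[OF l, of "A *v x"] lie_algebra_antisym[OF l, of "A *v y"]
        lie_algebra_antisym[OF l, of "A *v z"]
      by (simp add: semidirect_bracket_def bs ms D algebra_simps zero_prod_def)
  qed
  show ?thesis
    unfolding lie_algebra_def
    by (intro conjI bil jac' allI) (auto simp: semidirect_bracket_def alt zero_prod_def split: prod.splits)
qed

section \<open>Coordinates on the semidirect sum, and the moment matrix\<close>

lemma sum_Basis_vec:
  fixes f :: "real^'n \<Rightarrow> 'a::comm_monoid_add"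
  shows "(\<Sum>b\<in>Basis. f (b :: real^'n)) = (\<Sum>i\<in>UNIV. f (axis i 1))"
proof -
  have "(Basis :: (real^'n) set) = range (\<lambda>i. axis i 1)" by (auto simp: Basis_vec_def)
  then have "(\<Sum>b\<in>Basis. f b) = (\<Sum>b\<in>range (\<lambda>i. axis i 1). f b)" by (rule arg_cong)
  also have "\<dots> = (\<Sum>i\<in>UNIV. f (axis i 1))"
    by (subst sum.reindex) (auto simp: inj_on_def axis_eq_axis)
  finally show ?thesis .
qed

lemma sum_Basis_semidirect:
  fixes f :: "real \<times> (real^'n) \<Rightarrow> real"
  shows "(\<Sum>b\<in>Basis. f (b :: real \<times> (real^'n))) = f (1, 0) + (\<Sum>i\<in>UNIV. f (0, axis i 1))"
proof -
  have "(Basis :: (real \<times> (real^'n)) set) = insert (1, 0) (range (\<lambda>i. (0, axis i 1)))"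
    by (auto simp: Basis_prod_def Basis_vec_def)
  then have "(\<Sum>b\<in>Basis. f b) = (\<Sum>b\<in>insert (1, 0) (range (\<lambda>i. (0, axis i 1))). f b)"
    by (rule arg_cong)
  also have "\<dots> = f (1, 0) + (\<Sum>b\<in>range (\<lambda>i. (0, axis i 1)). f b)"
    by (subst sum.insert) auto
  also have "(\<Sum>b\<in>range (\<lambda>i. (0, axis i 1)). f b) = (\<Sum>i\<in>UNIV. f (0, axis i 1))"
    by (subst sum.reindex) (auto simp: inj_on_def axis_eq_axis)
  finally show ?thesis .
qed

text \<open>The unnormalised moment map |mu|^2 m(mu). It is polynomial in mu, hence continuous
  everywhere, including at 0. For a nilpotent bracket, half of it is the Ricci operator of the
  standard inner product. The factor 1/2 again accounts for ordered pairs.\<close>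

definition moment_matrix :: "(real^'n \<Rightarrow> real^'n \<Rightarrow> real^'n) \<Rightarrow> real^'n^'n" where
  "moment_matrix \<mu> = (\<chi> k l.
     (\<Sum>i\<in>UNIV. \<Sum>j\<in>UNIV. \<mu> (axis i 1) (axis j 1) $ k * \<mu> (axis i 1) (axis j 1) $ l) / 2
     - (\<Sum>j\<in>UNIV. \<mu> (axis k 1) (axis j 1) \<bullet> \<mu> (axis l 1) (axis j 1)))"

lemma matrix_quadratic_form:
  fixes M :: "real^'n^'n"
  shows "x \<bullet> (M *v y) = (\<Sum>k\<in>UNIV. \<Sum>l\<in>UNIV. x $ k * y $ l * M $ k $ l)"
  by (simp add: inner_vec_def matrix_vector_mult_def sum_distrib_left mult_ac)

lemma linear_axis_expansion:
  fixes f :: "real^'n \<Rightarrow> 'a::real_vector"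
  assumes "linear f"
  shows "f x = (\<Sum>k\<in>UNIV. x $ k *\<^sub>R f (axis k 1))"
proof -
  have "f x = f (\<Sum>k\<in>UNIV. x $ k *\<^sub>R axis k 1)"
    using basis_expansion[of x] by (simp add: scalar_mult_eq_scaleR)
  then show ?thesis by (simp only: linear_sum[OF assms] linear_scale[OF assms])
qed

lemma moment_matrix_quadratic_form:
  fixes \<mu> :: "real^'n \<Rightarrow> real^'n \<Rightarrow> real^'n"
  assumes "bilinear \<mu>"
  shows "x \<bullet> (moment_matrix \<mu> *v x) =
     (\<Sum>i\<in>UNIV. \<Sum>j\<in>UNIV. (\<mu> (axis i 1) (axis j 1) \<bullet> x)\<^sup>2) / 2
     - (\<Sum>j\<in>UNIV. \<mu> x (axis j 1) \<bullet> \<mu> x (axis j 1))"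
proof -
  let ?e = "\<lambda>i. axis i 1 :: real^'n"
  have lin: "linear (\<lambda>x. \<mu> x y)" for y using assms by (simp add: bilinear_def)
  have 1: "(v \<bullet> x)\<^sup>2 = (\<Sum>k\<in>UNIV. \<Sum>l\<in>UNIV. x $ k * x $ l * (v $ k * v $ l))" for v :: "real^'n"
    by (simp add: inner_vec_def power2_eq_square sum_product mult_ac)
  have 2: "\<mu> x y \<bullet> \<mu> x y = (\<Sum>k\<in>UNIV. \<Sum>l\<in>UNIV. x $ k * x $ l * (\<mu> (?e k) y \<bullet> \<mu> (?e l) y))" for y
    by (subst (1 2) linear_axis_expansion[OF lin, of x y])
       (simp add: inner_sum_left inner_sum_right sum_distrib_left inner_commute mult_ac)
  have s: "(\<Sum>i\<in>UNIV. \<Sum>k\<in>UNIV. \<Sum>l\<in>UNIV. x $ k * x $ l * g i k l)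
    = (\<Sum>k\<in>UNIV. \<Sum>l\<in>UNIV. x $ k * x $ l * (\<Sum>i\<in>UNIV. g i k l))" for g :: "'n \<Rightarrow> 'n \<Rightarrow> 'n \<Rightarrow> real"
    by (subst sum.swap, rule sum.cong[OF refl], subst sum.swap, simp add: sum_distrib_left)
  show ?thesis
    unfolding 1 2 s matrix_quadratic_form moment_matrix_def
    by (simp add: right_diff_distrib sum_subtractf sum_divide_distrib[symmetric])
qed

text \<open>Here f has length 1. The vanishing traces of the nilpotent part leave three
  contributions: the Ricci form of mu, the mean curvature term along A, and the square of the
  symmetric part of ad f, which is A itself.\<close>

lemma ricci_curvature_semidirect:
  fixes \<mu> :: "real^'n \<Rightarrow> real^'n \<Rightarrow> real^'n"
  assumes nil: "nilpotent_lie_algebra \<mu>" and A: "A \<in> Der \<mu>" and diag: "A \<in> diagonal_matrices"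
  shows "ricci_curvature (semidirect_bracket \<mu> A) inner (a, x) (a, x) =
    x \<bullet> (moment_matrix \<mu> *v x) / 2 - trace A * (x \<bullet> (A *v x)) - a\<^sup>2 * trace (A ** A)"
proof -
  let ?e = "\<lambda>i. axis i 1 :: real^'n"
  let ?s = "semidirect_bracket \<mu> A"
  have l: "lie_algebra \<mu>" using nil by (simp add: nilpotent_lie_algebra_def)
  then have b: "bilinear \<mu>" by (simp add: lie_algebra_def)
  note Ae = diagonal_matrix_vector_axis[OF diag] and Ax = diagonal_matrix_vector_component[OF diag]
  have trAA: "trace (A ** A) = (\<Sum>i\<in>UNIV. (A $ i $ i)\<^sup>2)"
    by (simp add: trace_def matrix_mult_diagonal_left[OF diag] power2_eq_square)
  have m0: "\<mu> y 0 = 0" "\<mu> 0 y = 0" for y using bilinear_rzero[OF b] bilinear_lzero[OF b] by auto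
  have s: "?s (c, y) (1, 0) = (0, - (A *v y))" "?s (c, y) (0, z) = (0, c *\<^sub>R (A *v z) + \<mu> y z)"
    for c y z by (simp_all add: semidirect_bracket_def m0)
  have t1: "(\<Sum>i\<in>UNIV. \<mu> y (?e i) $ i) = 0" for y
    using nilpotent_lie_algebra_traces(1)[OF nil, of y]
    by (simp add: endo_trace_def sum_Basis_vec inner_axis)
  define m where "m i j = \<mu> x (?e i) $ j" for i j
  have t2: "(\<Sum>i\<in>UNIV. \<Sum>j\<in>UNIV. m i j * m j i) = 0"
    using nilpotent_lie_algebra_traces(2)[OF nil, of x] b
    by (subst (asm) linear_axis_expansion[where x="\<mu> x _"])
       (simp_all add: bilinear_def endo_trace_def sum_Basis_vec inner_axis m_def)
  have t3: "(\<Sum>i\<in>UNIV. A $ i $ i * m i i) = 0"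
    using nilpotent_lie_algebra_traces(3)[OF nil A, of x]
    by (simp add: endo_trace_def sum_Basis_vec inner_axis m_def Ax)
  \<comment> \<open>Elements of the nilpotent part have traceless ad, so the mean curvature vector
    is tr A times f.\<close>
  have H: "(trace A, 0) \<bullet> Y = endo_trace (?s Y)" for Y
    by (cases Y) (simp add: endo_trace_def sum_Basis_semidirect s inner_axis sum.distrib t1 Ax
        trace_def sum_distrib_left mult.commute)
  have L: "(a *\<^sub>R (A *v ?e i) + \<mu> x (?e i)) \<bullet> ?e j = a * A $ i $ i * (if i = j then 1 else 0) + m i j" for i j
    by (simp add: Ae inner_axis m_def) (simp add: axis_def)
  \<comment> \<open>Expanding the square leaves two kinds of mixed terms: the products of a A_ii
    with m_ii vanish by \<open>t3\<close>, the products m_ij m_ji by \<open>t2\<close>.\<close>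
  have sq: "(\<Sum>i\<in>UNIV. \<Sum>j\<in>UNIV. ((a * A $ i $ i * (if i = j then 1 else 0) + m i j)
        + (a * A $ j $ j * (if j = i then 1 else 0) + m j i))\<^sup>2)
      = 4 * a\<^sup>2 * trace (A ** A) + 2 * (\<Sum>i\<in>UNIV. \<Sum>j\<in>UNIV. (m i j)\<^sup>2)"
  proof -
    have "((a * A $ i $ i * (if i = j then 1 else 0) + m i j)
        + (a * A $ j $ j * (if j = i then 1 else 0) + m j i))\<^sup>2
      = (if i = j then 4 * a\<^sup>2 * (A $ i $ i)\<^sup>2 + 8 * a * (A $ i $ i * m i i) else 0)
        + ((m i j)\<^sup>2 + (m j i)\<^sup>2 + 2 * (m i j * m j i))" for i j
      by (cases "i = j") (simp_all add: power2_eq_square algebra_simps)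
    moreover have "(\<Sum>i\<in>UNIV. \<Sum>j\<in>UNIV. (m j i)\<^sup>2) = (\<Sum>i\<in>UNIV. \<Sum>j\<in>UNIV. (m i j)\<^sup>2)"
      by (rule sum.swap)
    ultimately show ?thesis
      by (simp add: sum.distrib sum_distrib_left[symmetric] t2 t3 trAA)
  qed
  have nm: "(\<Sum>j\<in>UNIV. \<mu> x (?e j) \<bullet> \<mu> x (?e j)) = (\<Sum>i\<in>UNIV. \<Sum>j\<in>UNIV. (m i j)\<^sup>2)"
    by (simp add: inner_vec_def m_def power2_eq_square)
  \<comment> \<open>Brackets with f contribute 2 |A x|^2 here and the same amount to
    \<open>M\<close> below. Both sums enter the Ricci curvature with weight 1/4 and opposite signs,
    so this contribution cancels.\<close>
  have K: "(\<Sum>i\<in>Basis. \<Sum>j\<in>Basis. (?s i j \<bullet> (a, x))\<^sup>2)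
      = 2 * (\<Sum>i\<in>UNIV. (A $ i $ i * x $ i)\<^sup>2) + (\<Sum>i\<in>UNIV. \<Sum>j\<in>UNIV. (\<mu> (?e i) (?e j) \<bullet> x)\<^sup>2)"
    by (simp add: sum_Basis_semidirect s m0 Ae sum.distrib inner_axis')
  have M: "(\<Sum>i\<in>Basis. \<Sum>j\<in>Basis. (?s (a, x) i \<bullet> j + ?s (a, x) j \<bullet> i)\<^sup>2)
      = 2 * (\<Sum>i\<in>UNIV. (A $ i $ i * x $ i)\<^sup>2) + (4 * a\<^sup>2 * trace (A ** A) + 2 * (\<Sum>i\<in>UNIV. \<Sum>j\<in>UNIV. (m i j)\<^sup>2))"
    unfolding sq[symmetric] by (simp add: sum_Basis_semidirect s L sum.distrib) (simp add: inner_axis Ax)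
  have "ricci_curvature ?s inner (a, x) (a, x) =
      - (trace A * (x \<bullet> (A *v x)))
      + (2 * (\<Sum>i\<in>UNIV. (A $ i $ i * x $ i)\<^sup>2) + (\<Sum>i\<in>UNIV. \<Sum>j\<in>UNIV. (\<mu> (?e i) (?e j) \<bullet> x)\<^sup>2)) / 4
      - (2 * (\<Sum>i\<in>UNIV. (A $ i $ i * x $ i)\<^sup>2) + (4 * a\<^sup>2 * trace (A ** A) + 2 * (\<Sum>i\<in>UNIV. \<Sum>j\<in>UNIV. (m i j)\<^sup>2))) / 4"
    unfolding ricci_curvature_inner[OF lie_algebra_semidirect[OF l A] H] K M
    by (simp add: semidirect_bracket_def m0 inner_commute)
  then show ?thesis
    unfolding moment_matrix_quadratic_form[OF b] nm by (simp add: field_simps)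
qed

section \<open>Sorted diagonalization in the centralizer\<close>

text \<open>Right translation by h carries a connected set joining 1 to g into one joining h to g h,
  and h is itself joined to 1.\<close>

lemma G_group_mult:
  assumes g: "g \<in> G_group D" and h: "h \<in> G_group D"
  shows "g ** h \<in> G_group D"
proof -
  have hC: "h \<in> centralizer_GL D"
    using h connected_component_subset unfolding G_group_def by blast
  have cont: "continuous_on S (\<lambda>k. k ** h)" for S
    unfolding matrix_matrix_mult_def by (intro continuous_intros)
  obtain C where C: "connected C" "C \<subseteq> centralizer_GL D" "mat 1 \<in> C" "g \<in> C"
    using g by (auto simp: G_group_def connected_component_def)
  have "connected ((\<lambda>k. k ** h) ` C)" by (rule connected_continuous_image[OF cont C(1)])
  moreover have "(\<lambda>k. k ** h) ` C \<subseteq> centralizer_GL D"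
  proof clarify
    fix k assume "k \<in> C"
    then have k: "invertible k" "k ** D = D ** k" using C(2) by (auto simp: centralizer_GL_def)
    have "k ** h ** D = D ** (k ** h)"
      using commute_mult[OF k(2)] hC by (simp add: centralizer_GL_def)
    then show "k ** h \<in> centralizer_GL D"
      using k(1) hC by (simp add: centralizer_GL_def invertible_mult)
  qed
  ultimately have "connected_component (centralizer_GL D) h (g ** h)"
    unfolding connected_component_def
    using imageI[OF C(3), of "\<lambda>k. k ** h"] imageI[OF C(4), of "\<lambda>k. k ** h"]
    by (intro exI[of _ "(\<lambda>k. k ** h) ` C"]) simp
  then show ?thesis
    using h unfolding G_group_def mem_Collect_eq by (rule connected_component_trans[rotated])
qed

text \<open>Positive diagonal matrices form a convex, hence connected, subset of the centralizer
  that contains 1.\<close>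

lemma positive_diagonal_in_G_group:
  fixes D :: "real^'n^'n"
  assumes D: "D \<in> diagonal_matrices" and L: "L \<in> positive_diagonal_matrices"
  shows "L \<in> G_group D"
proof -
  have "convex (positive_diagonal_matrices :: (real^'n^'n) set)"
  proof (rule convexI)
    fix x y :: "real^'n^'n" and u v :: real
    assume "x \<in> positive_diagonal_matrices" "y \<in> positive_diagonal_matrices"
      and uv: "0 \<le> u" "0 \<le> v" "u + v = 1"
    then have xy: "x \<in> diagonal_matrices" "y \<in> diagonal_matrices" "\<And>i. x $ i $ i > 0" "\<And>i. y $ i $ i > 0"
      by (auto simp: positive_diagonal_matrices_def)
    have "u * x $ i $ i + v * y $ i $ i > 0" for i
    proof (cases "u = 0")
      case True
      then show ?thesis using uv xy(4) by simp
    next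
      case False
      then show ?thesis
        using uv xy(3,4)[of i] by (intro add_pos_nonneg mult_pos_pos mult_nonneg_nonneg) auto
    qed
    then show "u *\<^sub>R x + v *\<^sub>R y \<in> positive_diagonal_matrices"
      using xy(1,2) by (simp add: positive_diagonal_matrices_def diagonal_matrices_def)
  qed
  then have "connected (positive_diagonal_matrices :: (real^'n^'n) set)" by (rule convex_connected)
  moreover have "positive_diagonal_matrices \<subseteq> centralizer_GL D"
  proof
    fix P :: "real^'n^'n" assume P: "P \<in> positive_diagonal_matrices"
    then have Pd: "P \<in> diagonal_matrices" by (simp add: positive_diagonal_matrices_def)
    have "invertible P"
      unfolding invertible_def
    proof (intro exI conjI)
      let ?Q = "\<chi> k l. if k = l then inverse (P $ k $ k) else 0"
      show "P ** ?Q = mat 1" "?Q ** P = mat 1"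
        using P unfolding vec_eq_iff matrix_mult_diagonal_left[OF Pd] matrix_mult_diagonal_right[OF Pd]
        by (auto simp: mat_def positive_diagonal_matrices_def less_imp_neq[symmetric])
    qed
    moreover have "P ** D = D ** P"
      unfolding commute_diagonal_iff[OF D]
    proof (intro allI impI)
      fix k l assume "D $ k $ k \<noteq> D $ l $ l"
      then have "k \<noteq> l" by auto
      then show "P $ k $ l = 0" using Pd by (simp add: diagonal_matrices_def)
    qed
    ultimately show "P \<in> centralizer_GL D" by (simp add: centralizer_GL_def)
  qed
  moreover have "mat 1 \<in> positive_diagonal_matrices"
    by (simp add: positive_diagonal_matrices_def diagonal_matrices_def mat_def)
  ultimately show ?thesis
    using L unfolding G_group_def mem_Collect_eq connected_component_def by blast
qed

text \<open>Specified by rows, because conjugating A evaluates the form of A at the rows. The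
  parameters c and s stay algebraic, so that the variation can be studied as a quadratic form on the
  unit circle.\<close>

definition givens_rotation :: "'n::finite \<Rightarrow> 'n \<Rightarrow> real \<Rightarrow> real \<Rightarrow> real^'n^'n" where
  "givens_rotation i j c s = (\<chi> k. if k = i then c *\<^sub>R axis i 1 + s *\<^sub>R axis j 1
     else if k = j then c *\<^sub>R axis j 1 - s *\<^sub>R axis i 1 else axis k 1)"

lemma orthogonal_givens_rotation:
  assumes "i \<noteq> j" "c\<^sup>2 + s\<^sup>2 = 1"
  shows "orthogonal_matrix (givens_rotation i j c s)"
proof -
  have r: "row k (givens_rotation i j c s) = (if k = i then c *\<^sub>R axis i 1 + s *\<^sub>R axis j 1
     else if k = j then c *\<^sub>R axis j 1 - s *\<^sub>R axis i 1 else axis k 1)" for k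
    by (simp add: row_def givens_rotation_def vec_eq_iff)
  show ?thesis
    unfolding orthogonal_matrix_orthonormal_rows r orthogonal_def norm_eq_1
    using assms by (auto simp: inner_add_left inner_add_right inner_diff_left inner_diff_right
        inner_axis_axis power2_eq_square)
qed

lemma conjugate_entry: "(G ** A ** transpose G) $ k $ l = G $ k \<bullet> (A *v (G $ l))"
  for G A :: "real^'n^'n"
  by (simp add: matrix_quadratic_form matrix_matrix_mult_def transpose_def sum_distrib_right
      sum_distrib_left mult_ac) (rule sum.swap)

lemma givens_rotation_conjugate_diagonal:
  fixes A :: "real^'n^'n"
  assumes ij: "i \<noteq> j" and sym: "transpose A = A"
  shows "(givens_rotation i j c s ** A ** transpose (givens_rotation i j c s)) $ k $ k =
    (if k = i then c\<^sup>2 * A $ i $ i + 2 * c * s * A $ i $ j + s\<^sup>2 * A $ j $ j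
     else if k = j then c\<^sup>2 * A $ j $ j - 2 * c * s * A $ i $ j + s\<^sup>2 * A $ i $ i else A $ k $ k)"
proof -
  note e = inner_matrix_vector_axis
  have s: "A $ j $ i = A $ i $ j" using sym by (metis transpose_def vec_lambda_beta)
  show ?thesis
    unfolding conjugate_entry givens_rotation_def using ij
    by (auto simp: inner_add_left inner_add_right inner_diff_left inner_diff_right e s
        matrix_vector_right_distrib matrix_vector_mult_diff_distrib matrix_vector_mult_scaleR
        power2_eq_square algebra_simps)
qed

text \<open>Near (c, s) = (1, 0) the product c s is of first order and s^2 of second order, so a
  non-zero b would produce a positive value on one side. This is the first-order condition at a
  maximum; the sign of a is read off at (0, 1).\<close>

lemma quadratic_nonpos_imp:
  fixes a b :: real
  assumes "\<And>c s. c\<^sup>2 + s\<^sup>2 = 1 \<Longrightarrow> a * s\<^sup>2 + b * (c * s) \<le> 0"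
  shows "a \<le> 0" "b = 0"
proof -
  show "a \<le> 0" using assms[of 0 1] by simp
  show "b = 0"
  proof (rule ccontr)
    assume b: "b \<noteq> 0"
    \<comment> \<open>The point on the circle has slope t = b / p. Then a t^2 + b t = b^2 (a + p) /
      p^2, which is positive once p and a + p are; 1 + |a| is such a p.\<close>
    define p where "p = 1 + \<bar>a\<bar>"
    have p: "p > 0" "a + p > 0" by (auto simp: p_def)
    define t where "t = b / p"
    define n where "n = sqrt (1 + t\<^sup>2)"
    have n: "n\<^sup>2 = 1 + t\<^sup>2" "n > 0" by (auto simp: n_def intro: add_pos_nonneg)
    have "(1 / n)\<^sup>2 + (t / n)\<^sup>2 = (1 + t\<^sup>2) / n\<^sup>2" by (simp add: power_divide add_divide_distrib)
    also have "\<dots> = 1" using n by (metis divide_self less_numeral_extra(3) zero_less_power)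
    finally have "a * (t / n)\<^sup>2 + b * (1 / n * (t / n)) \<le> 0" by (rule assms)
    then have "(a * t\<^sup>2 + b * t) / n\<^sup>2 \<le> 0" by (simp add: power2_eq_square add_divide_distrib mult_ac)
    then have 1: "a * t\<^sup>2 + b * t \<le> 0" using n(2) by (simp add: divide_le_0_iff)
    have "a * t\<^sup>2 + b * t = b\<^sup>2 * (a + p) / p\<^sup>2"
      using p(1) unfolding t_def by (simp add: power2_eq_square field_simps)
    moreover have "\<dots> > 0" using b p by (intro divide_pos_pos mult_pos_pos) auto
    ultimately show False using 1 by simp
  qed
qed

text \<open>Compactness of this group provides maximisers. It contains the diagonal sign matrices
  and is disconnected, which is why only its component of 1 is used.\<close>

definition orthogonal_centralizer :: "real^'n^'n \<Rightarrow> (real^'n^'n) set" where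
  "orthogonal_centralizer D = {U. orthogonal_matrix U \<and> U ** D = D ** U}"

lemma compact_orthogonal_centralizer:
  fixes D :: "real^'n^'n"
  shows "compact (orthogonal_centralizer D)"
proof -
  have "closed {U::real^'n^'n. transpose U ** U = mat 1 \<and> U ** D = D ** U}"
    unfolding matrix_matrix_mult_def transpose_def
    by (intro closed_Collect_conj closed_Collect_eq continuous_intros)
  moreover have "norm U \<le> real CARD('n)" if "orthogonal_matrix U" for U :: "real^'n^'n"
  proof -
    have "(\<Sum>k\<in>UNIV. norm (U $ k)) = real CARD('n)"
      by (simp add: orthogonal_matrix_norm_row[OF that])
    moreover have "norm U \<le> (\<Sum>k\<in>UNIV. norm (U $ k))"
      by (simp add: norm_vec_def L2_set_le_sum)
    ultimately show ?thesis by simp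
  qed
  ultimately show ?thesis
    unfolding compact_eq_bounded_closed orthogonal_centralizer_def orthogonal_matrix
    by (auto intro!: boundedI[of _ "real CARD('n)"] simp: orthogonal_matrix)
qed

lemma orthogonal_centralizer_subset: "orthogonal_centralizer D \<subseteq> centralizer_GL D"
  by (auto simp: orthogonal_centralizer_def centralizer_GL_def orthogonal_matrix_def invertible_def)

text \<open>
  A maximiser of a weighted trace over the orthogonal centralizer is diagonal and sorted: rotating
  in the plane of \<open>i\<close> and \<open>j\<close> must not increase the weighted trace.
\<close>

lemma exists_sorting_diagonalization:
  fixes M D :: "real^'n^'n" and w :: "'n \<Rightarrow> real"
  assumes D: "D \<in> diagonal_matrices" and sym: "transpose M = M" and comm: "M ** D = D ** M"
  obtains U where "U \<in> G_group D" "orthogonal_matrix U"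
    "U ** M ** transpose U \<in> {A. transpose A = A \<and> A ** D = D ** A}"
    "\<And>i j. D $ i $ i = D $ j $ j \<Longrightarrow> w i < w j \<Longrightarrow>
        (U ** M ** transpose U) $ i $ j = 0
        \<and> (U ** M ** transpose U) $ i $ i \<le> (U ** M ** transpose U) $ j $ j"
proof -
  \<comment> \<open>The component is closed in a compact group, hence compact, and it lies in
    \<open>G_group D\<close>. The full orthogonal centralizer would give a maximiser that might lie
    outside of it.\<close>
  define K where "K = connected_component_set (orthogonal_centralizer D) (mat 1)"
  define F where "F U = (\<Sum>k\<in>UNIV. w k * (U ** M ** transpose U) $ k $ k)" for U
  have K_sub: "K \<subseteq> orthogonal_centralizer D"
    unfolding K_def by (rule connected_component_subset)
  have "closed K"
    unfolding K_def by (intro closed_connected_component compact_imp_closed compact_orthogonal_centralizer)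
  then have "compact K"
    using compact_Int_closed[OF compact_orthogonal_centralizer[of D], of K] K_sub by (simp add: Int_absorb1)
  moreover have "mat 1 \<in> orthogonal_centralizer D"
    by (simp add: orthogonal_centralizer_def orthogonal_matrix_id)
  then have "mat 1 \<in> K" by (simp add: K_def)
  moreover have "continuous_on K F"
    unfolding F_def matrix_matrix_mult_def transpose_def vec_lambda_beta by (intro continuous_intros)
  ultimately obtain U where U: "U \<in> K" and max: "\<And>V. V \<in> K \<Longrightarrow> F V \<le> F U"
    using continuous_attains_sup[of K F] by blast
  have oU: "orthogonal_matrix U" and cU: "U ** D = D ** U"
    using U K_sub by (auto simp: orthogonal_centralizer_def)
  have cUT: "transpose U ** D = D ** transpose U"
    using arg_cong[OF cU, of transpose] by (simp add: matrix_transpose_mul transpose_diagonal[OF D])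
  define A where "A = U ** M ** transpose U"
  have symA: "transpose A = A"
    by (simp add: A_def matrix_transpose_mul sym matrix_mul_assoc)
  have "A ** D = U ** M ** (transpose U ** D)" by (simp add: A_def matrix_mul_assoc)
  also have "\<dots> = U ** (M ** D) ** transpose U" unfolding cUT by (simp add: matrix_mul_assoc)
  also have "\<dots> = U ** D ** M ** transpose U" unfolding comm by (simp add: matrix_mul_assoc)
  also have "\<dots> = D ** A" unfolding cU by (simp add: A_def matrix_mul_assoc)
  finally have "A ** D = D ** A" .
  moreover have "A $ i $ j = 0 \<and> A $ i $ i \<le> A $ j $ j" if d: "D $ i $ i = D $ j $ j" and w: "w i < w j" for i j
  proof -
    have ij: "i \<noteq> j" using w by auto
    have orth: "givens_rotation i j (cos t) (sin t) ** U \<in> orthogonal_centralizer D" for t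
    proof -
      let ?G = "givens_rotation i j (cos t) (sin t)"
      have "?G ** D = D ** ?G"
        unfolding commute_diagonal_iff[OF D]
      proof (intro allI impI)
        fix k l assume kl: "D $ k $ k \<noteq> D $ l $ l"
        then have "l \<noteq> k" by auto
        with kl show "?G $ k $ l = 0"
          using d ij by (cases "k = i"; cases "k = j"; cases "l = i"; cases "l = j")
            (simp_all add: givens_rotation_def axis_def)
      qed
      then have "?G ** U ** D = D ** (?G ** U)" using cU by (rule commute_mult)
      moreover have "orthogonal_matrix (?G ** U)"
        by (rule orthogonal_matrix_mul[OF orthogonal_givens_rotation[OF ij] oU]) simp
      ultimately show ?thesis by (simp add: orthogonal_centralizer_def)
    qed
    \<comment> \<open>Letting the angle run through all reals gives a connected curve of competitors
      through U, which is reached at angle 0.\<close>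
    have inK: "givens_rotation i j c s ** U \<in> K" if cs: "c\<^sup>2 + s\<^sup>2 = 1" for c s
    proof -
      obtain t where t: "c = cos t" "s = sin t" using sincos_total_2pi[OF cs] by blast
      let ?P = "range (\<lambda>t. givens_rotation i j (cos t) (sin t) ** U)"
      have "continuous_on UNIV (\<lambda>t. givens_rotation i j (cos t) (sin t) $ k)" for k
        unfolding givens_rotation_def vec_lambda_beta
        by (cases "k = i"; cases "k = j") (simp_all, (intro continuous_intros)+)
      then have "continuous_on UNIV (\<lambda>t. \<chi> k. givens_rotation i j (cos t) (sin t) $ k)"
        by (rule continuous_on_vec_lambda)
      then have "continuous_on UNIV (\<lambda>t. givens_rotation i j (cos t) (sin t))"
        by simp
      then have "connected ?P"
        unfolding matrix_matrix_mult_def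
        by (intro connected_continuous_image continuous_intros connected_UNIV)
      moreover have "?P \<subseteq> orthogonal_centralizer D" using orth by blast
      moreover have "givens_rotation i j (cos 0) (sin 0) = mat 1"
        by (auto simp: givens_rotation_def mat_def axis_def vec_eq_iff)
      then have "U = givens_rotation i j (cos 0) (sin 0) ** U" by (simp only: matrix_mul_lid)
      then have "U \<in> ?P" by (rule range_eqI)
      ultimately have "connected_component (orthogonal_centralizer D) U (givens_rotation i j c s ** U)"
        unfolding connected_component_def t by blast
      then show ?thesis
        using U unfolding K_def mem_Collect_eq by (rule connected_component_trans[rotated])
    qed
    \<comment> \<open>The left-hand side is the change of the weighted trace under the rotation.
      Only the diagonal entries i and j move, and c^2 = 1 - s^2 eliminates the constant
      terms.\<close>
    have key: "(w i - w j) * (A $ j $ j - A $ i $ i) * s\<^sup>2 + 2 * (w i - w j) * A $ i $ j * (c * s) \<le> 0"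
      if cs: "c\<^sup>2 + s\<^sup>2 = 1" for c s
    proof -
      let ?G = "givens_rotation i j c s"
      define B where "B k = (?G ** A ** transpose ?G) $ k $ k" for k
      have B: "B k = (if k = i then c\<^sup>2 * A $ i $ i + 2 * c * s * A $ i $ j + s\<^sup>2 * A $ j $ j
         else if k = j then c\<^sup>2 * A $ j $ j - 2 * c * s * A $ i $ j + s\<^sup>2 * A $ i $ i else A $ k $ k)" for k
        unfolding B_def by (rule givens_rotation_conjugate_diagonal[OF ij symA])
      have c2: "c\<^sup>2 = 1 - s\<^sup>2" using cs by simp
      have "?G ** U ** M ** transpose (?G ** U) = ?G ** A ** transpose ?G"
        by (simp add: A_def matrix_transpose_mul matrix_mul_assoc)
      then have "F (?G ** U) = (\<Sum>k\<in>UNIV. w k * B k)" by (simp add: F_def B_def)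
      then have "(\<Sum>k\<in>UNIV. w k * B k) \<le> (\<Sum>k\<in>UNIV. w k * A $ k $ k)"
        using max[OF inK[OF cs]] by (simp add: F_def A_def)
      then have "(\<Sum>k\<in>UNIV. w k * (B k - A $ k $ k)) \<le> 0"
        by (simp add: right_diff_distrib sum_subtractf)
      moreover have "(\<Sum>k\<in>UNIV. w k * (B k - A $ k $ k)) = (\<Sum>k\<in>{i, j}. w k * (B k - A $ k $ k))"
        by (rule sum.mono_neutral_right) (auto simp: B)
      moreover have "\<dots> = (w i - w j) * (A $ j $ j - A $ i $ i) * s\<^sup>2 + 2 * (w i - w j) * A $ i $ j * (c * s)"
        using ij by (simp add: B c2 algebra_simps)
      ultimately show ?thesis by simp
    qed
    \<comment> \<open>Since w i - w j is negative, b = 0 makes the off-diagonal entry vanish, and a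
      \<le> 0 puts the two diagonal entries in the order of the weights.\<close>
    show ?thesis
      using quadratic_nonpos_imp[OF key] w by (auto simp: mult_le_0_iff)
  qed
  moreover have "U \<in> G_group D"
    using U connected_component_mono[OF orthogonal_centralizer_subset] unfolding K_def G_group_def by blast
  ultimately show ?thesis using that[of U] oU symA by (simp add: A_def)
qed

section \<open>The moment matrix along an orbit\<close>

lemma matrix_inv_unique:
  fixes A :: "real^'n^'n"
  assumes "A ** B = mat 1"
  shows "matrix_inv A = B"
proof -
  have BA: "B ** A = mat 1" using assms matrix_left_right_inverse by blast
  then have "A ** matrix_inv A = mat 1 \<and> matrix_inv A ** A = mat 1"
    unfolding matrix_inv_def
    by (intro someI[of "\<lambda>C. A ** C = mat 1 \<and> C ** A = mat 1" B] conjI assms)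
  then have "B ** (A ** matrix_inv A) = B" by simp
  then show ?thesis using BA by (simp add: matrix_mul_assoc)
qed

lemma matrix_inv_inverse:
  fixes A :: "real^'n^'n"
  assumes "invertible A"
  shows "A ** matrix_inv A = mat 1" "matrix_inv A ** A = mat 1"
proof -
  obtain B where B: "A ** B = mat 1" "B ** A = mat 1" using assms by (auto simp: invertible_def)
  then show "A ** matrix_inv A = mat 1" "matrix_inv A ** A = mat 1"
    by (simp_all add: matrix_inv_unique[OF B(1)])
qed

lemma matrix_inv_vector:
  fixes A :: "real^'n^'n"
  assumes "invertible A"
  shows "A *v (matrix_inv A *v x) = x" "matrix_inv A *v (A *v x) = x"
  using matrix_inv_inverse[OF assms] by (simp_all add: matrix_vector_mul_assoc)

lemma matrix_inv_orthogonal: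
  fixes U :: "real^'n^'n"
  shows "orthogonal_matrix U \<Longrightarrow> matrix_inv U = transpose U"
  by (rule matrix_inv_unique) (simp add: orthogonal_matrix_def)

lemma GL_action_mult:
  assumes "invertible g" "invertible h"
  shows "GL_action (g ** h) \<mu> = GL_action g (GL_action h \<mu>)"
proof -
  have "g ** h ** (matrix_inv h ** matrix_inv g) = g ** (h ** matrix_inv h) ** matrix_inv g"
    by (simp add: matrix_mul_assoc)
  then have "matrix_inv (g ** h) = matrix_inv h ** matrix_inv g"
    by (intro matrix_inv_unique) (simp add: matrix_inv_inverse assms)
  then show ?thesis by (simp add: GL_action_def matrix_vector_mul_assoc)
qed

lemma lie_algebra_skew_bilinear: "lie_algebra br \<Longrightarrow> br \<in> skew_bilinear_maps"
  unfolding skew_bilinear_maps_def mem_Collect_eq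
  by (intro conjI allI lie_algebra_antisym) (simp_all add: lie_algebra_def)

lemma nilpotent_GL_action:
  assumes "nilpotent_lie_algebra br" "invertible h"
  shows "nilpotent_lie_algebra (GL_action h br)"
  unfolding GL_action_def
  by (rule nilpotent_lie_algebra_transport[OF assms(1)])
     (simp_all add: matrix_vector_mul_linear matrix_inv_vector[OF assms(2)])

lemma centralizer_commute_vector:
  assumes "h \<in> centralizer_GL D"
  shows "D *v (h *v x) = h *v (D *v x)"
  using assms by (simp add: centralizer_GL_def matrix_vector_mul_assoc)

text \<open>Acting by h conjugates derivations by h, and h commutes with D.\<close>

lemma Der_GL_action:
  assumes h: "h \<in> centralizer_GL D" and D: "D \<in> Der br"
  shows "D \<in> Der (GL_action h br)"
proof -
  have inv: "invertible h" using h by (simp add: centralizer_GL_def)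
  have "matrix_inv h *v (D *v x) = D *v (matrix_inv h *v x)" for x
    using centralizer_commute_vector[OF h, of "matrix_inv h *v x"]
    by (metis matrix_inv_vector[OF inv])
  then show ?thesis
    using D by (simp add: Der_def GL_action_def centralizer_commute_vector[OF h] matrix_vector_right_distrib)
qed

lemma G_group_subset: "G_group D \<subseteq> centralizer_GL D"
  unfolding G_group_def by (rule connected_component_subset)

section \<open>Equivariance of the moment matrix, its weights and its relation to the moment
  map\<close>

lemma symmetric_quadratic_form_eq:
  fixes M N :: "real^'n^'n"
  assumes "transpose M = M" "transpose N = N" and q: "\<And>x. x \<bullet> (M *v x) = x \<bullet> (N *v x)"
  shows "M = N"
proof -
  note e = inner_matrix_vector_axis
  have s: "M $ l $ k = M $ k $ l" "N $ l $ k = N $ k $ l" for k l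
    using assms(1,2) by (metis transpose_def vec_lambda_beta)+
  have "M $ k $ l = N $ k $ l" for k l
    using q[of "axis k 1 + axis l 1"] q[of "axis k 1"] q[of "axis l 1"]
    by (simp add: inner_add_left inner_add_right matrix_vector_right_distrib e s)
  then show ?thesis by (simp add: vec_eq_iff)
qed

lemma bilinear_axis_expansion:
  fixes B :: "real^'n \<Rightarrow> real^'m \<Rightarrow> 'a::real_vector"
  assumes "bilinear B"
  shows "B x y = (\<Sum>k\<in>UNIV. \<Sum>l\<in>UNIV. (x $ k * y $ l) *\<^sub>R B (axis k 1) (axis l 1))"
proof -
  have l: "linear (\<lambda>x. B x y)" "linear (B x)" for x y using assms by (auto simp: bilinear_def)
  have "B x y = (\<Sum>k\<in>UNIV. x $ k *\<^sub>R B (axis k 1) y)" by (rule linear_axis_expansion[OF l(1)])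
  also have "\<dots> = (\<Sum>k\<in>UNIV. x $ k *\<^sub>R (\<Sum>l\<in>UNIV. y $ l *\<^sub>R B (axis k 1) (axis l 1)))"
    by (intro sum.cong refl arg_cong[where f="scaleR _"] linear_axis_expansion[OF l(2)])
  finally show ?thesis by (simp add: scaleR_sum_right)
qed

text \<open>The trace of a bilinear form is the same in every orthonormal frame. It serves to rotate
  the frames in the moment matrix back to the standard one, one summation index at a time.\<close>

lemma sum_bilinear_orthogonal:
  fixes B :: "real^'n \<Rightarrow> real^'n \<Rightarrow> real"
  assumes B: "bilinear B" and U: "orthogonal_matrix U"
  shows "(\<Sum>j\<in>UNIV. B (U *v axis j 1) (U *v axis j 1)) = (\<Sum>j\<in>UNIV. B (axis j 1) (axis j 1))"
proof -
  have exp: "B x y = (\<Sum>k\<in>UNIV. \<Sum>l\<in>UNIV. x $ k * y $ l * B (axis k 1) (axis l 1))" for x y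
    using bilinear_axis_expansion[OF B, of x y] by simp
  have Ue: "(U *v axis j 1) $ k = U $ k $ j" for j k
    by (simp add: matrix_vector_mul_component inner_axis)
  have "U ** transpose U = mat 1" using U by (simp add: orthogonal_matrix_def)
  then have UU: "(\<Sum>j\<in>UNIV. U $ k $ j * U $ l $ j) = (if k = l then 1 else 0)" for k l
    by (simp add: vec_eq_iff matrix_matrix_mult_def transpose_def mat_def)
  have "(\<Sum>j\<in>UNIV. B (U *v axis j 1) (U *v axis j 1))
      = (\<Sum>k\<in>UNIV. \<Sum>l\<in>UNIV. \<Sum>j\<in>UNIV. U $ k $ j * U $ l $ j * B (axis k 1) (axis l 1))"
    unfolding exp[of "U *v _" "U *v _"] Ue
    by (subst sum.swap, rule sum.cong[OF refl], subst sum.swap, rule refl)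
  also have "\<dots> = (\<Sum>k\<in>UNIV. B (axis k 1) (axis k 1))"
    by (simp add: sum_distrib_right[symmetric] UU if_distrib[of "\<lambda>x. x * _"] cong: if_cong)
  finally show ?thesis .
qed

lemma transpose_moment_matrix: "transpose (moment_matrix \<mu>) = moment_matrix \<mu>"
  by (simp add: vec_eq_iff transpose_def moment_matrix_def mult.commute inner_commute)

text \<open>Both sides are symmetric, so comparing quadratic forms is enough. Moving U to the other
  side of the inner products turns the form of the new bracket at x into that of mu at U^T x,
  computed in the frame U^T e_i; frame independence of the sums finishes the argument.\<close>

lemma moment_matrix_orthogonal_action:
  assumes b: "bilinear \<mu>" and U: "orthogonal_matrix U"
  shows "moment_matrix (GL_action U \<mu>) = U ** moment_matrix \<mu> ** transpose U"
proof (rule symmetric_quadratic_form_eq)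
  let ?V = "transpose U"
  have V: "orthogonal_matrix ?V" using U by simp
  note U2 = inner_matrix_vector_transpose[of U]
  have UU: "(U *v v) \<bullet> (U *v w) = v \<bullet> w" for v w
    using U by (simp only: U2 matrix_vector_mul_assoc orthogonal_matrix matrix_vector_mul_lid)
  have act: "GL_action U \<mu> = (\<lambda>x y. U *v \<mu> (?V *v x) (?V *v y))"
    by (simp add: GL_action_def matrix_inv_orthogonal[OF U])
  note bs = bilinear_ladd[OF b] bilinear_radd[OF b] bilinear_lmul[OF b] bilinear_rmul[OF b]
  note ms = matrix_vector_right_distrib matrix_vector_mult_scaleR
  have bU: "bilinear (GL_action U \<mu>)"
    unfolding act bilinear_def by (intro conjI allI linearI) (simp_all add: bs ms)
  fix x
  have "(\<Sum>i\<in>UNIV. \<Sum>j\<in>UNIV. (\<mu> (?V *v axis i 1) (?V *v axis j 1) \<bullet> (?V *v x))\<^sup>2)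
      = (\<Sum>i\<in>UNIV. \<Sum>j\<in>UNIV. (\<mu> (?V *v axis i 1) (axis j 1) \<bullet> (?V *v x))\<^sup>2)"
  proof (rule sum.cong[OF refl])
    fix i
    \<comment> \<open>The square is read as the diagonal value of a bilinear form in the second slot
      of mu, so that frame independence applies.\<close>
    have "bilinear (\<lambda>u v. (\<mu> (?V *v axis i 1) u \<bullet> (?V *v x)) * (\<mu> (?V *v axis i 1) v \<bullet> (?V *v x)))"
      unfolding bilinear_def by (intro conjI allI linearI) (simp_all add: bs inner_add_left algebra_simps)
    from sum_bilinear_orthogonal[OF this V]
    show "(\<Sum>j\<in>UNIV. (\<mu> (?V *v axis i 1) (?V *v axis j 1) \<bullet> (?V *v x))\<^sup>2)
        = (\<Sum>j\<in>UNIV. (\<mu> (?V *v axis i 1) (axis j 1) \<bullet> (?V *v x))\<^sup>2)"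
      by (simp add: power2_eq_square)
  qed
  also have "\<dots> = (\<Sum>j\<in>UNIV. \<Sum>i\<in>UNIV. (\<mu> (?V *v axis i 1) (axis j 1) \<bullet> (?V *v x))\<^sup>2)"
    by (rule sum.swap)
  also have "\<dots> = (\<Sum>j\<in>UNIV. \<Sum>i\<in>UNIV. (\<mu> (axis i 1) (axis j 1) \<bullet> (?V *v x))\<^sup>2)"
  proof (rule sum.cong[OF refl])
    fix j
    have "bilinear (\<lambda>u v. (\<mu> u (axis j 1) \<bullet> (?V *v x)) * (\<mu> v (axis j 1) \<bullet> (?V *v x)))"
      unfolding bilinear_def by (intro conjI allI linearI) (simp_all add: bs inner_add_left algebra_simps)
    from sum_bilinear_orthogonal[OF this V]
    show "(\<Sum>i\<in>UNIV. (\<mu> (?V *v axis i 1) (axis j 1) \<bullet> (?V *v x))\<^sup>2)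
        = (\<Sum>i\<in>UNIV. (\<mu> (axis i 1) (axis j 1) \<bullet> (?V *v x))\<^sup>2)"
      by (simp add: power2_eq_square)
  qed
  also have "\<dots> = (\<Sum>i\<in>UNIV. \<Sum>j\<in>UNIV. (\<mu> (axis i 1) (axis j 1) \<bullet> (?V *v x))\<^sup>2)"
    by (rule sum.swap)
  finally have 1: "(\<Sum>i\<in>UNIV. \<Sum>j\<in>UNIV. (\<mu> (?V *v axis i 1) (?V *v axis j 1) \<bullet> (?V *v x))\<^sup>2)
      = (\<Sum>i\<in>UNIV. \<Sum>j\<in>UNIV. (\<mu> (axis i 1) (axis j 1) \<bullet> (?V *v x))\<^sup>2)" .
  have "bilinear (\<lambda>u v. \<mu> (?V *v x) u \<bullet> \<mu> (?V *v x) v)"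
    unfolding bilinear_def by (intro conjI allI linearI) (simp_all add: bs inner_add_left inner_add_right)
  from sum_bilinear_orthogonal[OF this V]
  have 2: "(\<Sum>j\<in>UNIV. \<mu> (?V *v x) (?V *v axis j 1) \<bullet> \<mu> (?V *v x) (?V *v axis j 1))
      = (\<Sum>j\<in>UNIV. \<mu> (?V *v x) (axis j 1) \<bullet> \<mu> (?V *v x) (axis j 1))" .
  have "x \<bullet> (moment_matrix (GL_action U \<mu>) *v x) = (?V *v x) \<bullet> (moment_matrix \<mu> *v (?V *v x))"
    unfolding moment_matrix_quadratic_form[OF bU] moment_matrix_quadratic_form[OF b]
    by (simp only: act UU) (simp only: U2 1 2)
  also have "\<dots> = x \<bullet> (U *v (moment_matrix \<mu> *v (?V *v x)))"
    by (metis U2 inner_commute)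
  also have "\<dots> = x \<bullet> ((U ** moment_matrix \<mu> ** ?V) *v x)"
    by (simp only: matrix_vector_mul_assoc matrix_mul_assoc)
  finally show "x \<bullet> (moment_matrix (GL_action U \<mu>) *v x) = x \<bullet> ((U ** moment_matrix \<mu> ** ?V) *v x)" .
qed (simp_all add: transpose_moment_matrix matrix_transpose_mul matrix_mul_assoc)

text \<open>The derivation property is a weight condition: mu(e_i, e_j) has a k-th coordinate only
  if d_k = d_i + d_j. In the entry (k, l) each summand is a product of two structure constants, and
  both can be non-zero only if d_k = d_l.\<close>

lemma moment_matrix_commute:
  assumes D: "D \<in> diagonal_matrices" "D \<in> Der \<mu>" and b: "bilinear \<mu>"
  shows "moment_matrix \<mu> ** D = D ** moment_matrix \<mu>"
proof -
  note De = diagonal_matrix_vector_axis[OF D(1)] and Dx = diagonal_matrix_vector_component[OF D(1)]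
  have root: "\<mu> (axis i 1) (axis j 1) $ k = 0 \<or> D $ k $ k = D $ i $ i + D $ j $ j" for i j k
  proof -
    have "D *v \<mu> (axis i 1) (axis j 1) = (D $ i $ i + D $ j $ j) *\<^sub>R \<mu> (axis i 1) (axis j 1)"
      using D(2) by (simp add: Der_def De bilinear_lmul[OF b] bilinear_rmul[OF b] scaleR_add_left)
    from arg_cong[OF this, of "\<lambda>v. v $ k"] show ?thesis by (auto simp: Dx)
  qed
  show ?thesis
    unfolding commute_diagonal_iff[OF D(1)]
  proof (intro allI impI)
    fix k l assume kl: "D $ k $ k \<noteq> D $ l $ l"
    have 1: "\<mu> (axis i 1) (axis j 1) $ k * \<mu> (axis i 1) (axis j 1) $ l = 0" for i j
      using root[of i j k] root[of i j l] kl by auto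
    have 2: "\<mu> (axis k 1) (axis j 1) $ p * \<mu> (axis l 1) (axis j 1) $ p = 0" for j p
      using root[of k j p] root[of l j p] kl by auto
    show "moment_matrix \<mu> $ k $ l = 0"
      by (simp add: moment_matrix_def inner_vec_def 1 2 del: mult_eq_0_iff)
  qed
qed

text \<open>By skew symmetry the terms mu(E x, y) and mu(x, E y) contribute equally to the pairing
  of E.mu with mu, which cancels the 1/2 of \<open>V_inner\<close> there and leaves it on the term E
  mu(x, y). The coefficients of E are then the entries of \<open>moment_matrix\<close>. At mu = 0
  both sides are 0, by the convention for division by zero.\<close>

lemma moment_map_eq:
  fixes \<mu> :: "real^'n \<Rightarrow> real^'n \<Rightarrow> real^'n"
  assumes \<mu>: "\<mu> \<in> skew_bilinear_maps"
  shows "moment_map \<mu> = (1 / V_inner \<mu> \<mu>) *\<^sub>R moment_matrix \<mu>"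
proof -
  let ?e = "\<lambda>i. axis i 1 :: real^'n"
  have b: "bilinear \<mu>" and skew: "\<And>x y. \<mu> x y = - \<mu> y x"
    using \<mu> unfolding skew_bilinear_maps_def by blast+
  have lin: "linear (\<lambda>x. \<mu> x y)" for y using b by (simp add: bilinear_def)
  have key: "V_inner (gl_action E \<mu>) \<mu> = trace (moment_matrix \<mu> ** transpose E)" for E
  proof -
    have "(\<Sum>i\<in>UNIV. \<Sum>j\<in>UNIV. \<mu> (?e i) (E *v ?e j) \<bullet> \<mu> (?e i) (?e j))
        = (\<Sum>i\<in>UNIV. \<Sum>j\<in>UNIV. \<mu> (E *v ?e j) (?e i) \<bullet> \<mu> (?e j) (?e i))"
    proof (intro sum.cong refl)
      fix i j
      show "\<mu> (?e i) (E *v ?e j) \<bullet> \<mu> (?e i) (?e j) = \<mu> (E *v ?e j) (?e i) \<bullet> \<mu> (?e j) (?e i)"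
        unfolding skew[of "?e i" "E *v ?e j"] skew[of "?e i" "?e j"] by simp
    qed
    also have "\<dots> = (\<Sum>j\<in>UNIV. \<Sum>i\<in>UNIV. \<mu> (E *v ?e j) (?e i) \<bullet> \<mu> (?e j) (?e i))"
      by (rule sum.swap)
    finally have 0: "(\<Sum>i\<in>UNIV. \<Sum>j\<in>UNIV. \<mu> (?e i) (E *v ?e j) \<bullet> \<mu> (?e i) (?e j))
        = (\<Sum>j\<in>UNIV. \<Sum>i\<in>UNIV. \<mu> (E *v ?e j) (?e i) \<bullet> \<mu> (?e j) (?e i))" .
    have 1: "V_inner (gl_action E \<mu>) \<mu> =
        (\<Sum>i\<in>UNIV. \<Sum>j\<in>UNIV. (E *v \<mu> (?e i) (?e j)) \<bullet> \<mu> (?e i) (?e j)) / 2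
        - (\<Sum>i\<in>UNIV. \<Sum>j\<in>UNIV. \<mu> (E *v ?e i) (?e j) \<bullet> \<mu> (?e i) (?e j))"
      by (simp add: V_inner_def gl_action_def inner_diff_left sum_subtractf 0)
    have s: "(\<Sum>i\<in>UNIV. \<Sum>k\<in>UNIV. \<Sum>l\<in>UNIV. E $ k $ l * g i k l)
        = (\<Sum>k\<in>UNIV. \<Sum>l\<in>UNIV. E $ k $ l * (\<Sum>i\<in>UNIV. g i k l))" for g :: "'n \<Rightarrow> 'n \<Rightarrow> 'n \<Rightarrow> real"
      by (subst sum.swap, rule sum.cong[OF refl], subst sum.swap, simp add: sum_distrib_left)
    have "(E *v v) \<bullet> v = (\<Sum>k\<in>UNIV. \<Sum>l\<in>UNIV. E $ k $ l * (v $ k * v $ l))" for v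
      using matrix_quadratic_form[of v E v] by (simp add: inner_commute mult_ac)
    then have 2: "(\<Sum>i\<in>UNIV. \<Sum>j\<in>UNIV. (E *v \<mu> (?e i) (?e j)) \<bullet> \<mu> (?e i) (?e j))
      = (\<Sum>k\<in>UNIV. \<Sum>l\<in>UNIV. E $ k $ l * (\<Sum>i\<in>UNIV. \<Sum>j\<in>UNIV. \<mu> (?e i) (?e j) $ k * \<mu> (?e i) (?e j) $ l))"
      by (simp add: s)
    have "\<mu> (E *v ?e l) y = (\<Sum>k\<in>UNIV. E $ k $ l *\<^sub>R \<mu> (?e k) y)" for l y
      by (subst linear_axis_expansion[OF lin]) (simp add: matrix_vector_mul_component inner_axis)
    then have "(\<Sum>l\<in>UNIV. \<Sum>j\<in>UNIV. \<mu> (E *v ?e l) (?e j) \<bullet> \<mu> (?e l) (?e j))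
      = (\<Sum>l\<in>UNIV. \<Sum>k\<in>UNIV. E $ k $ l * (\<Sum>j\<in>UNIV. \<mu> (?e k) (?e j) \<bullet> \<mu> (?e l) (?e j)))"
      by (simp add: inner_sum_left sum_distrib_left) (intro sum.cong refl sum.swap)
    also have "\<dots> = (\<Sum>k\<in>UNIV. \<Sum>l\<in>UNIV. E $ k $ l * (\<Sum>j\<in>UNIV. \<mu> (?e k) (?e j) \<bullet> \<mu> (?e l) (?e j)))"
      by (rule sum.swap)
    finally show ?thesis
      unfolding 1 2
      by (simp add: trace_def matrix_matrix_mult_def transpose_def moment_matrix_def
          right_diff_distrib sum_subtractf sum_divide_distrib[symmetric] mult.commute)
  qed
  show ?thesis
    unfolding moment_map_def
  proof (rule the1_equality[OF moment_map_ex1[OF \<mu>]], intro conjI ballI)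
    let ?M = "(1 / V_inner \<mu> \<mu>) *\<^sub>R moment_matrix \<mu>"
    have "moment_matrix \<mu> $ j $ i = moment_matrix \<mu> $ i $ j" for i j
      using transpose_moment_matrix[of \<mu>] by (metis transpose_def vec_lambda_beta)
    then show "?M \<in> symmetric_matrices"
      by (simp add: symmetric_matrices_def vec_eq_iff transpose_def)
    show "trace (?M ** transpose E) = V_inner (gl_action E \<mu>) \<mu> / V_inner \<mu> \<mu>" for E
      unfolding key by (simp add: trace_def matrix_matrix_mult_def sum_divide_distrib)
  qed
qed

lemma V_inner_pos:
  fixes \<mu> :: "real^'n \<Rightarrow> real^'n \<Rightarrow> real^'n"
  assumes b: "bilinear \<mu>" and nz: "\<mu> \<noteq> (\<lambda>x y. 0)"
  shows "V_inner \<mu> \<mu> > 0"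
proof -
  have "V_inner \<mu> \<mu> \<ge> 0" by (simp add: V_inner_def sum_nonneg)
  moreover have "V_inner \<mu> \<mu> \<noteq> 0"
  proof
    assume "V_inner \<mu> \<mu> = 0"
    then have z: "\<mu> (axis i 1) (axis j 1) = 0" for i j
      by (simp add: V_inner_def sum_nonneg_eq_0_iff sum_nonneg)
    have "\<mu> x y = 0" for x y using bilinear_axis_expansion[OF b, of x y] z by simp
    then have "\<mu> = (\<lambda>x y. 0)" by (intro ext)
    then show False using nz by simp
  qed
  ultimately show ?thesis by simp
qed

text \<open>The map (a, x) \<mapsto> (sqrt c a, h x) is an isometric isomorphism onto the semidirect
  sum of h.[.,.] with the standard inner product. Two factors 1 / sqrt c give tr D / c on the
  nilpotent part, whereas along f the factors cancel, the curvature being evaluated as a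
  form.\<close>

lemma ricci_curvature_rescaled_semidirect:
  fixes br :: "real^'n \<Rightarrow> real^'n \<Rightarrow> real^'n" and D h :: "real^'n^'n"
  defines "\<mu> \<equiv> GL_action h br"
  assumes nil: "nilpotent_lie_algebra br" and D: "D \<in> Der br" "D \<in> diagonal_matrices"
    and h: "h \<in> centralizer_GL D" and c: "c > 0" and ip: "is_inner_product g"
    and g: "\<And>a x b y. g (a, x) (b, y) = c * a * b + (h *v x) \<bullet> (h *v y)"
  shows "ricci_curvature (semidirect_bracket br D) g (a, x) (a, x) =
    (h *v x) \<bullet> (moment_matrix \<mu> *v (h *v x)) / 2 - trace D / c * ((h *v x) \<bullet> (D *v (h *v x)))
      - a\<^sup>2 * trace (D ** D)"
proof -
  have inv: "invertible h" using h by (simp add: centralizer_GL_def)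
  \<comment> \<open>The unit vector f / sqrt c acts on the nilpotent part by D / sqrt c.\<close>
  define A where "A = (1 / sqrt c) *\<^sub>R D"
  define T where "T = (\<lambda>(a, x). (sqrt c * a, h *v x))"
  define T' where "T' = (\<lambda>(a, x). (a / sqrt c, matrix_inv h *v x))"
  have sc: "sqrt c > 0" "sqrt c * sqrt c = c" using c by auto
  have nil': "nilpotent_lie_algebra \<mu>" unfolding \<mu>_def by (rule nilpotent_GL_action[OF nil inv])
  then have l': "lie_algebra \<mu>" by (simp add: nilpotent_lie_algebra_def)
  then have b': "bilinear \<mu>" by (simp add: lie_algebra_def)
  have Av: "A *v v = (1 / sqrt c) *\<^sub>R (D *v v)" for v
    by (simp add: A_def scaleR_matrix_vector_assoc)
  have "D \<in> Der \<mu>" unfolding \<mu>_def by (rule Der_GL_action[OF h D(1)])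
  then have A: "A \<in> Der \<mu>"
    by (simp add: Der_def Av bilinear_lmul[OF b'] bilinear_rmul[OF b'] scaleR_add_right)
  have Ad: "A \<in> diagonal_matrices" using D(2) by (simp add: A_def diagonal_matrices_def)
  have hmu: "h *v br x y = \<mu> (h *v x) (h *v y)" for x y
    by (simp add: \<mu>_def GL_action_def matrix_inv_vector[OF inv])
  have "ricci_curvature (semidirect_bracket br D) g (a, x) (a, x)
      = ricci_curvature (semidirect_bracket \<mu> A) inner (T (a, x)) (T (a, x))"
  proof (rule ricci_curvature_isometry[where T'=T'])
    show "lie_algebra (semidirect_bracket br D)"
      using nil D(1) by (intro lie_algebra_semidirect) (auto simp: nilpotent_lie_algebra_def)
    show "lie_algebra (semidirect_bracket \<mu> A)" by (rule lie_algebra_semidirect[OF l' A])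
    show "linear T" "linear T'"
      by (rule linearI; auto simp: T_def T'_def matrix_vector_right_distrib matrix_vector_mult_scaleR
          algebra_simps add_divide_distrib)+
    show "T (T' X) = X" "T' (T X) = X" for X
      using sc by (auto simp: T_def T'_def matrix_inv_vector[OF inv] split: prod.splits)
    show "T (semidirect_bracket br D X Y) = semidirect_bracket \<mu> A (T X) (T Y)" for X Y
      using sc by (auto simp: T_def semidirect_bracket_def Av centralizer_commute_vector[OF h] hmu
          matrix_vector_right_distrib matrix_vector_mult_diff_distrib matrix_vector_mult_scaleR
          split: prod.splits)
    show "g X Y = T X \<bullet> T Y" for X Y
      using sc by (cases X; cases Y) (simp add: T_def g algebra_simps)
  qed (simp_all add: ip is_inner_product_inner)
  also have "\<dots> = (h *v x) \<bullet> (moment_matrix \<mu> *v (h *v x)) / 2 - trace A * ((h *v x) \<bullet> (A *v (h *v x)))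
      - (sqrt c * a)\<^sup>2 * trace (A ** A)"
    unfolding T_def by (simp add: ricci_curvature_semidirect[OF nil' A Ad])
  also have "trace A * ((h *v x) \<bullet> (A *v (h *v x))) = trace D / c * ((h *v x) \<bullet> (D *v (h *v x)))"
  proof -
    have tA: "trace A = trace D / sqrt c" by (simp add: A_def trace_def sum_divide_distrib)
    show ?thesis unfolding Av tA inner_scaleR_right using c by simp
  qed
  also have "(sqrt c * a)\<^sup>2 * trace (A ** A) = a\<^sup>2 * trace (D ** D)"
  proof -
    have "trace (A ** A) = trace (D ** D) / (sqrt c * sqrt c)"
      by (simp add: A_def trace_def matrix_matrix_mult_def sum_divide_distrib)
    then show ?thesis using c by (simp add: power_mult_distrib)
  qed
  finally show ?thesis .
qed

section \<open>Weyl chambers\<close>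

lemma weyl_chambers_nonempty: "weyl_chambers D \<noteq> {}"
proof -
  have "\<forall>c. \<exists>r. linear_order_on {i. D $ i $ i = c} r"
    using well_order_on unfolding well_order_on_def by blast
  then obtain R where "\<forall>c. linear_order_on {i. D $ i $ i = c} (R c)" by metis
  then show ?thesis unfolding weyl_chambers_def by blast
qed

lemma weyl_chamber_subset: "\<aa> \<in> weyl_chambers D \<Longrightarrow> \<aa> \<subseteq> diagonal_matrices"
  by (auto simp: weyl_chambers_def)

text \<open>Chambers are cones, so the normalisation of the moment map by |mu|^2 does not affect
  membership.\<close>

lemma weyl_chamber_scale:
  fixes D A :: "real^'n^'n"
  assumes a: "\<aa> \<in> weyl_chambers D" and r: "r > 0" and A: "A \<in> \<aa>"
  shows "r *\<^sub>R A \<in> \<aa>"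
proof -
  obtain R :: "real \<Rightarrow> ('n \<times> 'n) set"
    where R: "\<aa> = {A \<in> diagonal_matrices. \<forall>c. \<forall>(i, j)\<in>R c. A $ i $ i \<le> A $ j $ j}"
    using a by (auto simp: weyl_chambers_def)
  have "(r *\<^sub>R A) $ i $ i \<le> (r *\<^sub>R A) $ j $ j" if "(i, j) \<in> R c" for i j c
  proof -
    have "A $ i $ i \<le> A $ j $ j" using A that unfolding R by blast
    then show ?thesis using r by simp
  qed
  moreover have "r *\<^sub>R A \<in> diagonal_matrices" using A unfolding R by (simp add: diagonal_matrices_def)
  ultimately show ?thesis unfolding R by blast
qed

text \<open>A linear order on a finite block is recovered from the ranks of its elements. The rank
  serves as the weight in the trace that is maximised; weights of different blocks are never
  compared.\<close>

lemma weyl_chamber_weight: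
  fixes D :: "real^'n^'n"
  assumes "\<aa> \<in> weyl_chambers D"
  obtains w :: "'n \<Rightarrow> real"
  where "\<And>i j. D $ i $ i = D $ j $ j \<Longrightarrow> i \<noteq> j \<Longrightarrow> w i \<noteq> w j"
    and "\<And>A. A \<in> diagonal_matrices \<Longrightarrow>
      (\<And>i j. D $ i $ i = D $ j $ j \<Longrightarrow> w i < w j \<Longrightarrow> A $ i $ i \<le> A $ j $ j) \<Longrightarrow> A \<in> \<aa>"
proof -
  obtain R where R: "\<And>c. linear_order_on {i. D $ i $ i = c} (R c)"
    and a: "\<aa> = {A \<in> diagonal_matrices. \<forall>c. \<forall>(i, j)\<in>R c. A $ i $ i \<le> A $ j $ j}"
    using assms by (auto simp: weyl_chambers_def)
  \<comment> \<open>The number of predecessors of i within its own block, i included. It increases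
    strictly along the order: the predecessors of a larger j contain those of i and also j
    itself.\<close>
  define w where "w i = real (card {k. (k, i) \<in> R (D $ i $ i)})" for i
  have R_sub: "D $ i $ i = c \<and> D $ j $ j = c" if "(i, j) \<in> R c" for i j c
    using R[of c] that
    by (auto simp: linear_order_on_def partial_order_on_def preorder_on_def refl_on_def)
  have less: "w i < w j" if ij: "(i, j) \<in> R c" "i \<noteq> j" for i j c
  proof -
    have c: "D $ i $ i = c" "D $ j $ j = c" using R_sub[OF ij(1)] by auto
    have tr: "trans (R c)" and an: "antisym (R c)" and rf: "refl_on {i. D $ i $ i = c} (R c)"
      using R[of c] by (auto simp: linear_order_on_def partial_order_on_def preorder_on_def)
    have "{k. (k, i) \<in> R c} \<subseteq> {k. (k, j) \<in> R c}" using tr ij(1) by (auto dest: transD)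
    moreover have "j \<in> {k. (k, j) \<in> R c}" using rf c by (auto simp: refl_on_def)
    moreover have "j \<notin> {k. (k, i) \<in> R c}" using an ij by (auto dest: antisymD)
    ultimately have "{k. (k, i) \<in> R c} \<subset> {k. (k, j) \<in> R c}" by blast
    then have "card {k. (k, i) \<in> R c} < card {k. (k, j) \<in> R c}" by (rule psubset_card_mono[rotated]) simp
    then show ?thesis by (simp add: w_def c)
  qed
  show ?thesis
  proof (rule that)
    show "w i \<noteq> w j" if "D $ i $ i = D $ j $ j" "i \<noteq> j" for i j
    proof -
      have "total_on {k. D $ k $ k = D $ j $ j} (R (D $ j $ j))"
        using R by (simp add: linear_order_on_def)
      then have "(i, j) \<in> R (D $ j $ j) \<or> (j, i) \<in> R (D $ j $ j)"
        using that by (simp add: total_on_def)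
      then show ?thesis using less that(2) by fastforce
    qed
    show "A \<in> \<aa>" if A: "A \<in> diagonal_matrices"
      and le: "\<And>i j. D $ i $ i = D $ j $ j \<Longrightarrow> w i < w j \<Longrightarrow> A $ i $ i \<le> A $ j $ j" for A
    proof -
      have "A $ i $ i \<le> A $ j $ j" if "(i, j) \<in> R c" for i j c
        using le[of i j] less[OF that] R_sub[OF that] by (cases "i = j") auto
      then show ?thesis using A by (auto simp: a)
    qed
  qed
qed

text \<open>Entries between different blocks vanish because the conjugate still commutes with D.
  Within a block the weights are distinct, so the sorting property applies to every pair.\<close>

lemma weyl_chamber_conjugation:
  fixes D M :: "real^'n^'n"
  assumes D: "D \<in> diagonal_matrices" and M: "transpose M = M" "M ** D = D ** M"
    and a: "\<aa> \<in> weyl_chambers D"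
  obtains U where "U \<in> G_group D" "orthogonal_matrix U" "U ** M ** transpose U \<in> \<aa>"
proof (rule weyl_chamber_weight[OF a])
  fix w :: "'n \<Rightarrow> real"
  assume w: "\<And>i j. D $ i $ i = D $ j $ j \<Longrightarrow> i \<noteq> j \<Longrightarrow> w i \<noteq> w j"
    and sort: "\<And>A. A \<in> diagonal_matrices \<Longrightarrow>
      (\<And>i j. D $ i $ i = D $ j $ j \<Longrightarrow> w i < w j \<Longrightarrow> A $ i $ i \<le> A $ j $ j) \<Longrightarrow> A \<in> \<aa>"
  obtain U where U: "U \<in> G_group D" "orthogonal_matrix U"
    and UM: "U ** M ** transpose U \<in> {A. transpose A = A \<and> A ** D = D ** A}"
    and srt: "\<And>i j. D $ i $ i = D $ j $ j \<Longrightarrow> w i < w j \<Longrightarrow>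
        (U ** M ** transpose U) $ i $ j = 0
        \<and> (U ** M ** transpose U) $ i $ i \<le> (U ** M ** transpose U) $ j $ j"
    by (rule exists_sorting_diagonalization[OF D M, where w=w]) blast
  define A where "A = U ** M ** transpose U"
  have sym: "transpose A = A" and com: "A ** D = D ** A" using UM by (auto simp: A_def)
  have s: "A $ i $ j = A $ j $ i" for i j
    using sym by (metis transpose_def vec_lambda_beta)
  have "A $ i $ j = 0" if "i \<noteq> j" for i j
  proof (cases "D $ i $ i = D $ j $ j")
    case True
    then have "w i < w j \<or> w j < w i" using w[OF True that] by auto
    then show ?thesis using srt[of i j] srt[of j i] True s[of i j] by (auto simp: A_def[symmetric])
  next
    case False
    then show ?thesis using com unfolding commute_diagonal_iff[OF D] by blast
  qed
  then have "A \<in> diagonal_matrices" by (simp add: diagonal_matrices_def)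
  then have "A \<in> \<aa>" using srt by (intro sort) (auto simp: A_def[symmetric])
  then show ?thesis using that U by (simp add: A_def)
qed

section \<open>Ricci negative derivations\<close>

text \<open>If U Q U^T = P is diagonal and L is the diagonal root of P, then S = L U satisfies S^T S
  = Q. The condition fixes only S^T S, so S may be taken as a product of two elements of
  \<open>G_group D\<close>.\<close>

lemma positive_definite_root:
  fixes D Q :: "real^'n^'n"
  assumes D: "D \<in> diagonal_matrices" and Q: "transpose Q = Q" "Q ** D = D ** Q"
    and pos: "\<And>x. x \<noteq> 0 \<Longrightarrow> x \<bullet> (Q *v x) > 0"
  obtains S where "S \<in> G_group D" "\<And>x y. (S *v x) \<bullet> (S *v y) = x \<bullet> (Q *v y)"
proof -
  \<comment> \<open>Any chamber will do: only the diagonal form of the conjugate is used.\<close>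
  obtain \<aa> where a: "\<aa> \<in> weyl_chambers D" using weyl_chambers_nonempty[of D] by blast
  obtain U where U: "U \<in> G_group D" "orthogonal_matrix U" and Ua: "U ** Q ** transpose U \<in> \<aa>"
    by (rule weyl_chamber_conjugation[OF D Q a])
  define P where "P = U ** Q ** transpose U"
  have Pd: "P \<in> diagonal_matrices" using Ua weyl_chamber_subset[OF a] by (auto simp: P_def)
  \<comment> \<open>The diagonal entry is the value of the form Q at the i-th row of U, a unit
    vector.\<close>
  have Pp: "P $ i $ i > 0" for i
  proof -
    have "U $ i \<noteq> 0" using orthogonal_matrix_norm_row[OF U(2), of i] by auto
    then show ?thesis unfolding P_def conjugate_entry by (rule pos)
  qed
  define L :: "real^'n^'n" where "L = (\<chi> i j. if i = j then sqrt (P $ i $ i) else 0)"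
  have L: "L \<in> positive_diagonal_matrices" using Pp by (simp add: L_def positive_diagonal_matrices_def diagonal_matrices_def)
  then have Ld: "L \<in> diagonal_matrices" by (simp add: positive_diagonal_matrices_def)
  have Lt: "transpose L = L" by (auto simp: L_def transpose_def vec_eq_iff)
  have LL: "L ** L = P"
    unfolding vec_eq_iff matrix_mult_diagonal_left[OF Ld]
    using Pp Pd by (auto simp: L_def diagonal_matrices_def less_imp_le)
  have "transpose U ** P ** U = (transpose U ** U) ** Q ** (transpose U ** U)"
    by (simp add: P_def matrix_mul_assoc)
  then have UPU: "transpose U ** P ** U = Q" using U(2) by (simp add: orthogonal_matrix)
  have "((L ** U) *v x) \<bullet> ((L ** U) *v y) = x \<bullet> (Q *v y)" for x y
  proof -
    have "transpose (L ** U) ** (L ** U) = transpose U ** (L ** L) ** U"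
      by (simp add: matrix_transpose_mul Lt matrix_mul_assoc)
    then show ?thesis unfolding inner_matrix_vector_transpose by (simp only: matrix_vector_mul_assoc LL UPU)
  qed
  moreover have "L ** U \<in> G_group D"
    by (rule G_group_mult[OF positive_diagonal_in_G_group[OF D L] U(1)])
  ultimately show ?thesis using that by blast
qed

text \<open>This removes curvature from the problem: the choice of a metric becomes the choice of an
  orbit point and of one positive number. The Ricci form has no mixed terms between f and the
  nilpotent part, so the two directions can be treated separately.\<close>

lemma ricci_negative_iff:
  fixes br :: "real^'n \<Rightarrow> real^'n \<Rightarrow> real^'n" and D :: "real^'n^'n"
  assumes nil: "nilpotent_lie_algebra br" and D: "D \<in> Der br" "D \<in> diagonal_matrices"
    and tr: "trace D > 0"
  shows "ricci_negative br D \<longleftrightarrow> (\<exists>h\<in>G_group D. \<exists>r>0. \<forall>x. x \<noteq> 0 \<longrightarrow>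
     x \<bullet> (D *v x) - r * (x \<bullet> (moment_matrix (GL_action h br) *v x)) > 0)"
proof
  assume "ricci_negative br D"
  then obtain g where ip: "is_inner_product g"
    and symD: "\<And>x y. g (0, D *v x) (0, y) = g (0, x) (0, D *v y)"
    and perp: "\<And>x. g (1, 0) (0, x) = 0"
    and neg: "\<And>X. X \<noteq> 0 \<Longrightarrow> ricci_curvature (semidirect_bracket br D) g X X < 0"
    unfolding ricci_negative_def by blast
  have bil: "bilinear g" and sym: "\<And>X Y. g X Y = g Y X" and pos: "\<And>X. X \<noteq> 0 \<Longrightarrow> g X X > 0"
    using ip by (auto simp: is_inner_product_def)
  define c where "c = g (1, 0) (1, 0)"
  have c: "c > 0" using pos[of "(1, 0)"] by (simp add: c_def zero_prod_def)
  define G where "G x y = g (0, x) (0, y)" for x y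
  have Gl: "linear (\<lambda>x. G x y)" "linear (G x)" for x y
    using bilinear_ladd[OF bil, of "(0, _)" "(0, _)"] bilinear_radd[OF bil, of _ "(0, _)" "(0, _)"]
      bilinear_lmul[OF bil, of _ "(0, _)"] bilinear_rmul[OF bil, of _ _ "(0, _)"]
    by (auto intro!: linearI simp: G_def)
  define Q :: "real^'n^'n" where "Q = (\<chi> i j. G (axis i 1) (axis j 1))"
  have GQ: "G x y = x \<bullet> (Q *v y)" for x y
    unfolding matrix_quadratic_form
    using bilinear_axis_expansion[of G x y] Gl by (simp add: bilinear_def Q_def)
  have Qt: "transpose Q = Q" using sym by (simp add: Q_def transpose_def vec_eq_iff G_def)
  note De = diagonal_matrix_vector_axis[OF D(2)]
  have "Q ** D = D ** Q"
    unfolding commute_diagonal_iff[OF D(2)]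
  proof (intro allI impI)
    fix k l assume "D $ k $ k \<noteq> D $ l $ l"
    moreover have "D $ k $ k * Q $ k $ l = D $ l $ l * Q $ k $ l"
      using symD[of "axis k 1" "axis l 1"]
      unfolding G_def[symmetric] De linear_scale[OF Gl(1)] linear_scale[OF Gl(2)] by (simp add: Q_def)
    ultimately show "Q $ k $ l = 0" by simp
  qed
  moreover have "x \<bullet> (Q *v x) > 0" if "x \<noteq> 0" for x
    using pos[of "(0, x)"] that by (simp add: GQ[symmetric] G_def zero_prod_def)
  ultimately obtain S where S: "S \<in> G_group D" and SQ: "\<And>x y. (S *v x) \<bullet> (S *v y) = x \<bullet> (Q *v y)"
    using positive_definite_root[OF D(2) Qt] by blast
  have SC: "S \<in> centralizer_GL D" using S G_group_subset by blast
  then have inv: "invertible S" by (simp add: centralizer_GL_def)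
  have gS: "g (a, x) (b, y) = c * a * b + (S *v x) \<bullet> (S *v y)" for a x b y
  proof -
    have "g (a, x) (b, y) = g (a *\<^sub>R (1, 0) + (0, x)) (b *\<^sub>R (1, 0) + (0, y))" by simp
    also have "\<dots> = c * a * b + G x y"
      unfolding bilinear_ladd[OF bil] bilinear_radd[OF bil] bilinear_lmul[OF bil] bilinear_rmul[OF bil]
      using perp[of x] perp[of y] sym[of "(0, x)" "(1, 0)"] by (simp add: c_def G_def)
    finally show ?thesis by (simp add: GQ SQ)
  qed
  \<comment> \<open>Dividing the inequality M / 2 - (tr D / c) D < 0 by tr D / c gives r = c / (2 tr
    D).\<close>
  show "\<exists>h\<in>G_group D. \<exists>r>0. \<forall>x. x \<noteq> 0 \<longrightarrow>
     x \<bullet> (D *v x) - r * (x \<bullet> (moment_matrix (GL_action h br) *v x)) > 0"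
  proof (intro bexI[OF _ S] exI[of _ "c / (2 * trace D)"] conjI allI impI)
    show "c / (2 * trace D) > 0" using c tr by simp
    fix y :: "real^'n" assume y: "y \<noteq> 0"
    define x where "x = matrix_inv S *v y"
    have Sx: "S *v x = y" by (simp add: x_def matrix_inv_vector[OF inv])
    then have "(0, x) \<noteq> 0" using y by (auto simp: zero_prod_def)
    from neg[OF this] have "y \<bullet> (moment_matrix (GL_action S br) *v y) / 2 - trace D / c * (y \<bullet> (D *v y)) < 0"
      unfolding ricci_curvature_rescaled_semidirect[OF nil D SC c ip gS] Sx by simp
    then show "y \<bullet> (D *v y) - c / (2 * trace D) * (y \<bullet> (moment_matrix (GL_action S br) *v y)) > 0"
      using c tr by (simp add: field_simps)
  qed
next
  assume "\<exists>h\<in>G_group D. \<exists>r>0. \<forall>x. x \<noteq> 0 \<longrightarrow>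
     x \<bullet> (D *v x) - r * (x \<bullet> (moment_matrix (GL_action h br) *v x)) > 0"
  then obtain h r where hG: "h \<in> G_group D" and r: "r > 0"
    and pd: "\<And>x. x \<noteq> 0 \<Longrightarrow> x \<bullet> (D *v x) - r * (x \<bullet> (moment_matrix (GL_action h br) *v x)) > 0"
    by blast
  have h: "h \<in> centralizer_GL D" using hG G_group_subset by blast
  then have inv: "invertible h" by (simp add: centralizer_GL_def)
  \<comment> \<open>The length of f that makes c / (2 tr D) equal to the given r.\<close>
  define c where "c = 2 * r * trace D"
  have c: "c > 0" using r tr by (simp add: c_def)
  define g where "g = (\<lambda>(a, x) (b, y). c * a * b + (h *v x) \<bullet> (h *v y))"
  have g: "g (a, x) (b, y) = c * a * b + (h *v x) \<bullet> (h *v y)" for a x b y by (simp add: g_def)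
  have hx: "h *v x \<noteq> 0" if "x \<noteq> 0" for x
    using that matrix_inv_vector(2)[OF inv, of x] by auto
  have ip: "is_inner_product g"
    unfolding is_inner_product_def
  proof (intro conjI allI impI)
    show "bilinear g"
      unfolding bilinear_def
      by (intro conjI allI linearI; clarsimp simp: g matrix_vector_right_distrib matrix_vector_mult_scaleR
          inner_add_left inner_add_right algebra_simps)
    show "g X Y = g Y X" for X Y by (cases X; cases Y) (simp add: g inner_commute)
    show "g X X > 0" if "X \<noteq> 0" for X
    proof (cases X)
      case (Pair a x)
      show ?thesis
      proof (cases "x = 0")
        case True
        then have "a \<noteq> 0" using that Pair by (auto simp: zero_prod_def)
        then have "c * (a * a) > 0" using c by (metis mult_pos_pos not_real_square_gt_zero)
        then show ?thesis by (simp add: True Pair g mult.assoc)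
      next
        case False
        have "c * a * a \<ge> 0" using c by (simp add: mult.assoc)
        moreover have "(h *v x) \<bullet> (h *v x) > 0" using hx[OF False] by simp
        ultimately show ?thesis unfolding Pair g by (rule add_nonneg_pos)
      qed
    qed
  qed
  \<comment> \<open>A diagonal matrix of non-zero trace has a non-zero entry; this makes the
    curvature in the direction of f strictly negative.\<close>
  have trDD: "trace (D ** D) > 0"
  proof -
    have e: "trace (D ** D) = (\<Sum>i\<in>UNIV. (D $ i $ i)\<^sup>2)"
      by (simp add: trace_def matrix_mult_diagonal_left[OF D(2)] power2_eq_square)
    have "\<exists>i. D $ i $ i \<noteq> 0"
    proof (rule ccontr)
      assume "\<nexists>i. D $ i $ i \<noteq> 0"
      then have "trace D = 0" by (simp add: trace_def)
      then show False using tr by simp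
    qed
    then obtain i where "D $ i $ i \<noteq> 0" ..
    then show ?thesis unfolding e by (intro sum_pos2[of _ i]) auto
  qed
  show "ricci_negative br D"
    unfolding ricci_negative_def
  proof (intro conjI D(1) tr exI[of _ g] ip allI impI)
    show "g (0, D *v x) (0, y) = g (0, x) (0, D *v y)" for x y
      unfolding g centralizer_commute_vector[OF h, symmetric]
      by (simp only: inner_matrix_vector_transpose[of D] transpose_diagonal[OF D(2)])
    show "g (1, 0) (0, x) = 0" for x by (simp add: g)
    fix X :: "real \<times> (real^'n)" assume X: "X \<noteq> 0"
    obtain a x where Xax: "X = (a, x)" by (cases X)
    define y where "y = h *v x"
    let ?E = "y \<bullet> (D *v y) - r * (y \<bullet> (moment_matrix (GL_action h br) *v y))"
    have ric: "ricci_curvature (semidirect_bracket br D) g X X = - (?E / (2 * r)) - a\<^sup>2 * trace (D ** D)"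
      unfolding Xax ricci_curvature_rescaled_semidirect[OF nil D h c ip g] y_def[symmetric] c_def
      using r tr by (simp add: field_simps)
    show "ricci_curvature (semidirect_bracket br D) g X X < 0"
    proof (cases "x = 0")
      case True
      then have "a \<noteq> 0" "y = 0" using X Xax by (auto simp: zero_prod_def y_def)
      then show ?thesis unfolding ric using trDD by simp
    next
      case False
      then have "?E / (2 * r) > 0" using pd[of y] hx[of x] r by (simp add: y_def)
      moreover have "a\<^sup>2 * trace (D ** D) \<ge> 0" using trDD by simp
      ultimately show ?thesis unfolding ric by linarith
    qed
  qed
qed

section \<open>Cones over the moment image\<close>

text \<open>\<open>moment_matrix\<close> and \<open>moment_map\<close> differ by the positive factor
  |mu|^2. It is absorbed into r, and into \<open>\<aa>\<close> because that set is a cone.\<close>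

lemma positive_cone_plus_moment_image_iff:
  fixes D :: "real^'n^'n"
  assumes S: "S \<subseteq> skew_bilinear_maps" and cone: "\<And>r A. r > 0 \<Longrightarrow> A \<in> \<aa> \<Longrightarrow> r *\<^sub>R A \<in> \<aa>"
  shows "D \<in> positive_cone_plus (moment_image S \<inter> \<aa>) positive_diagonal_matrices \<longleftrightarrow>
    (\<exists>\<mu>\<in>S. \<mu> \<noteq> (\<lambda>x y. 0) \<and> (\<exists>r>0. moment_matrix \<mu> \<in> \<aa> \<and>
       D - r *\<^sub>R moment_matrix \<mu> \<in> positive_diagonal_matrices))"
proof -
  have V: "V_inner \<mu> \<mu> > 0" and mm: "moment_map \<mu> = (1 / V_inner \<mu> \<mu>) *\<^sub>R moment_matrix \<mu>"
    if "\<mu> \<in> S" "\<mu> \<noteq> (\<lambda>x y. 0)" for \<mu>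
  proof -
    have sk: "\<mu> \<in> skew_bilinear_maps" using that(1) S by blast
    then have "bilinear \<mu>" unfolding skew_bilinear_maps_def by blast
    then show "V_inner \<mu> \<mu> > 0" by (rule V_inner_pos[OF _ that(2)])
    show "moment_map \<mu> = (1 / V_inner \<mu> \<mu>) *\<^sub>R moment_matrix \<mu>" by (rule moment_map_eq[OF sk])
  qed
  show ?thesis
  proof
    assume "D \<in> positive_cone_plus (moment_image S \<inter> \<aa>) positive_diagonal_matrices"
    then obtain r \<mu> P where r: "r > 0" and \<mu>: "\<mu> \<in> S" "\<mu> \<noteq> (\<lambda>x y. 0)" "moment_map \<mu> \<in> \<aa>"
      and P: "P \<in> positive_diagonal_matrices" "D = r *\<^sub>R moment_map \<mu> + P"
      by (auto simp: positive_cone_plus_def moment_image_def)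
    let ?v = "V_inner \<mu> \<mu>"
    have "moment_matrix \<mu> = ?v *\<^sub>R moment_map \<mu>" using V[OF \<mu>(1,2)] by (simp add: mm[OF \<mu>(1,2)])
    then have "moment_matrix \<mu> \<in> \<aa>" using cone[OF V[OF \<mu>(1,2)] \<mu>(3)] by simp
    moreover have "D - (r / ?v) *\<^sub>R moment_matrix \<mu> = P"
      by (simp add: P(2) mm[OF \<mu>(1,2)])
    moreover have "r / ?v > 0" using r V[OF \<mu>(1,2)] by simp
    ultimately show "\<exists>\<mu>\<in>S. \<mu> \<noteq> (\<lambda>x y. 0) \<and> (\<exists>r>0. moment_matrix \<mu> \<in> \<aa> \<and>
       D - r *\<^sub>R moment_matrix \<mu> \<in> positive_diagonal_matrices)"
      using \<mu>(1,2) P(1) by metis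
  next
    assume "\<exists>\<mu>\<in>S. \<mu> \<noteq> (\<lambda>x y. 0) \<and> (\<exists>r>0. moment_matrix \<mu> \<in> \<aa> \<and>
       D - r *\<^sub>R moment_matrix \<mu> \<in> positive_diagonal_matrices)"
    then obtain \<mu> r where \<mu>: "\<mu> \<in> S" "\<mu> \<noteq> (\<lambda>x y. 0)" and r: "r > 0" and a: "moment_matrix \<mu> \<in> \<aa>"
      and P: "D - r *\<^sub>R moment_matrix \<mu> \<in> positive_diagonal_matrices" by blast
    let ?v = "V_inner \<mu> \<mu>"
    have v: "?v > 0" by (rule V[OF \<mu>])
    have "moment_map \<mu> \<in> moment_image S \<inter> \<aa>"
      using \<mu> cone[OF _ a, of "1 / ?v"] v by (simp add: mm[OF \<mu>] moment_image_def) (metis DiffI imageI mm[OF \<mu>] singletonD)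
    moreover have "D = (r * ?v) *\<^sub>R moment_map \<mu> + (D - r *\<^sub>R moment_matrix \<mu>)"
      using v by (simp add: mm[OF \<mu>])
    moreover have "r * ?v > 0" using r v by simp
    ultimately show "D \<in> positive_cone_plus (moment_image S \<inter> \<aa>) positive_diagonal_matrices"
      unfolding positive_cone_plus_def using P by blast
  qed
qed

text \<open>Conjugation by an orthogonal U of \<open>G_group D\<close> fixes D and carries the
  moment matrix at h.[.,.] to the one at (U h).[.,.]. Hence the same r works after moving into the
  chamber, and positive definiteness turns into positivity of the diagonal entries.\<close>

lemma orbit_chamber:
  fixes br :: "real^'n \<Rightarrow> real^'n \<Rightarrow> real^'n" and D :: "real^'n^'n"
  assumes nil: "nilpotent_lie_algebra br" and nab: "\<not> abelian_lie_algebra br"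
    and D: "D \<in> Der br" "D \<in> diagonal_matrices" and a: "\<aa> \<in> weyl_chambers D" and h: "h \<in> G_group D"
    and pd: "\<And>x. x \<noteq> 0 \<Longrightarrow> x \<bullet> (D *v x) - r * (x \<bullet> (moment_matrix (GL_action h br) *v x)) > 0"
  shows "\<exists>\<mu>\<in>G_orbit D br. \<mu> \<noteq> (\<lambda>x y. 0) \<and> moment_matrix \<mu> \<in> \<aa> \<and>
     D - r *\<^sub>R moment_matrix \<mu> \<in> positive_diagonal_matrices"
proof -
  let ?\<mu> = "GL_action h br"
  have hC: "h \<in> centralizer_GL D" using h G_group_subset by blast
  then have inv: "invertible h" by (simp add: centralizer_GL_def)
  have "nilpotent_lie_algebra ?\<mu>" by (rule nilpotent_GL_action[OF nil inv])
  then have b: "bilinear ?\<mu>" by (simp add: nilpotent_lie_algebra_def lie_algebra_def)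
  have comm: "moment_matrix ?\<mu> ** D = D ** moment_matrix ?\<mu>"
    by (rule moment_matrix_commute[OF D(2) Der_GL_action[OF hC D(1)] b])
  obtain U where U: "U \<in> G_group D" "orthogonal_matrix U"
    and Ua: "U ** moment_matrix ?\<mu> ** transpose U \<in> \<aa>"
    by (rule weyl_chamber_conjugation[OF D(2) transpose_moment_matrix comm a])
  have UC: "U ** D = D ** U" "invertible U" using U(1) G_group_subset by (auto simp: centralizer_GL_def)
  have Uh: "U ** h \<in> G_group D" by (rule G_group_mult[OF U(1) h])
  define \<nu> where "\<nu> = GL_action (U ** h) br"
  have "\<nu> = GL_action U ?\<mu>" unfolding \<nu>_def by (rule GL_action_mult[OF UC(2) inv])
  then have m\<nu>: "moment_matrix \<nu> = U ** moment_matrix ?\<mu> ** transpose U"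
    by (simp add: moment_matrix_orthogonal_action[OF b U(2)])
  have \<nu>: "\<nu> \<in> G_orbit D br" using Uh by (auto simp: \<nu>_def G_orbit_def)
  \<comment> \<open>The action is invertible, so a zero bracket in the orbit would make the original
    one abelian.\<close>
  have \<nu>0: "\<nu> \<noteq> (\<lambda>x y. 0)"
  proof
    assume z: "\<nu> = (\<lambda>x y. 0)"
    have iU: "invertible (U ** h)" by (rule invertible_mult[OF UC(2) inv])
    have "br x y = 0" for x y
    proof -
      have "(U ** h) *v br x y = \<nu> ((U ** h) *v x) ((U ** h) *v y)"
        unfolding \<nu>_def GL_action_def by (simp only: matrix_inv_vector[OF iU])
      then have "matrix_inv (U ** h) *v ((U ** h) *v br x y) = 0" by (simp add: z)
      then show ?thesis by (simp only: matrix_inv_vector[OF iU])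
    qed
    then show False using nil nab by (simp add: nilpotent_lie_algebra_def abelian_lie_algebra_def)
  qed
  have UDU: "U ** D ** transpose U = D"
  proof -
    have "U ** D ** transpose U = D ** (U ** transpose U)" unfolding UC(1) by (simp add: matrix_mul_assoc)
    then show ?thesis using U(2) by (simp add: orthogonal_matrix_def)
  qed
  have "moment_matrix \<nu> \<in> diagonal_matrices" using Ua weyl_chamber_subset[OF a] by (auto simp: m\<nu>)
  \<comment> \<open>The entry is the value of the positive definite form at the i-th row of
    U.\<close>
  moreover have "(D - r *\<^sub>R moment_matrix \<nu>) $ i $ i > 0" for i
  proof -
    have "U $ i \<noteq> 0" using orthogonal_matrix_norm_row[OF U(2), of i] by auto
    from pd[OF this] have "(U ** D ** transpose U) $ i $ i - r * (U ** moment_matrix ?\<mu> ** transpose U) $ i $ i > 0"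
      by (simp only: conjugate_entry)
    then show ?thesis by (simp add: UDU m\<nu>)
  qed
  ultimately have "D - r *\<^sub>R moment_matrix \<nu> \<in> positive_diagonal_matrices"
    using D(2) by (simp add: positive_diagonal_matrices_def diagonal_matrices_def)
  then show ?thesis using \<nu> \<nu>0 Ua m\<nu> by auto
qed

section \<open>Openness of positive definiteness\<close>

lemma norm_matrix_vector_le:
  fixes B :: "real^'n^'n"
  shows "norm (B *v x) \<le> norm B * norm x"
proof -
  have "norm (B *v x) = L2_set (\<lambda>k. norm (B $ k \<bullet> x)) UNIV"
    by (simp add: norm_vec_def matrix_vector_mul_component)
  also have "\<dots> \<le> L2_set (\<lambda>k. norm (B $ k) * norm x) UNIV"
    by (intro L2_set_mono) (simp_all add: Cauchy_Schwarz_ineq2)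
  also have "\<dots> = norm B * norm x"
    by (simp add: L2_set_left_distrib[symmetric] norm_vec_def)
  finally show ?thesis .
qed

lemma continuous_on_moment_matrix: "continuous_on UNIV moment_matrix"
proof -
  have cont: "continuous_on UNIV (\<lambda>\<nu>::real^'n \<Rightarrow> real^'n \<Rightarrow> real^'n. \<nu> x y)" for x y
    by (rule continuous_on_product_then_coordinatewise[where f="\<lambda>\<nu>. \<nu> x" and i=y],
        rule continuous_on_product_then_coordinatewise[where f="\<lambda>\<nu>. \<nu>" and i=x],
        rule continuous_on_id)
  show ?thesis
    unfolding moment_matrix_def[abs_def] by (intro continuous_intros cont) simp
qed

text \<open>The moment matrix depends continuously on the bracket, so it moves by less than the
  smallest eigenvalue permits when mu is close to \<nu>. The conclusion is stated for the quadratic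
  form, since diagonality may be lost on the way from \<nu> to mu.\<close>

lemma closure_positive_definite:
  fixes br :: "real^'n \<Rightarrow> real^'n \<Rightarrow> real^'n" and D :: "real^'n^'n"
  assumes \<nu>: "\<nu> \<in> closure_in_V S" and r: "r > 0"
    and P: "D - r *\<^sub>R moment_matrix \<nu> \<in> positive_diagonal_matrices"
  shows "\<exists>\<mu>\<in>S. \<forall>x. x \<noteq> 0 \<longrightarrow> x \<bullet> (D *v x) - r * (x \<bullet> (moment_matrix \<mu> *v x)) > 0"
proof -
  let ?P = "D - r *\<^sub>R moment_matrix \<nu>"
  \<comment> \<open>The smallest eigenvalue of the positive diagonal matrix; perturbations of norm
    below it preserve positive definiteness.\<close>
  define p where "p = Min (range (\<lambda>i. ?P $ i $ i))"
  have Pd: "?P \<in> diagonal_matrices" and Pp: "\<And>i. ?P $ i $ i > 0"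
    using P by (auto simp: positive_diagonal_matrices_def)
  have p: "p > 0" and ple: "\<And>i. p \<le> ?P $ i $ i"
    using Pp by (auto simp: p_def)
  define W where "W = {\<mu>. r * norm (moment_matrix \<mu> - moment_matrix \<nu>) < p}"
  have "open W"
    unfolding W_def by (intro open_Collect_less continuous_intros continuous_on_moment_matrix)
  then have op: "openin (top_of_set skew_bilinear_maps) (skew_bilinear_maps \<inter> W)"
    by (rule openin_open_Int)
  have cl: "\<nu> \<in> skew_bilinear_maps"
    "\<And>T. \<nu> \<in> T \<Longrightarrow> openin (top_of_set skew_bilinear_maps) T \<Longrightarrow> \<exists>y\<in>S. y \<in> T"
    using \<nu> unfolding closure_in_V_def in_closure_of topspace_euclidean_subtopology by blast+
  have "\<nu> \<in> W" using p by (simp add: W_def)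
  then obtain \<mu> where \<mu>: "\<mu> \<in> S" "\<mu> \<in> W" using cl(2)[OF _ op] cl(1) by blast
  have "x \<bullet> (D *v x) - r * (x \<bullet> (moment_matrix \<mu> *v x)) > 0" if "x \<noteq> 0" for x
  proof -
    let ?B = "moment_matrix \<mu> - moment_matrix \<nu>"
    have "x \<bullet> (?B *v x) \<le> norm x * norm (?B *v x)" by (rule norm_cauchy_schwarz)
    also have "\<dots> \<le> norm x * (norm ?B * norm x)" by (intro mult_left_mono norm_matrix_vector_le) simp
    finally have "r * (x \<bullet> (?B *v x)) \<le> r * (norm x * (norm ?B * norm x))" using r by (intro mult_left_mono) auto
    also have "\<dots> = (r * norm ?B) * (x \<bullet> x)" by (simp add: dot_square_norm power2_eq_square)
    also have "\<dots> < p * (x \<bullet> x)" using \<mu>(2) that by (intro mult_strict_right_mono) (auto simp: W_def)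
    also have "\<dots> \<le> x \<bullet> (?P *v x)"
    proof -
      have "x \<bullet> (?P *v x) = (\<Sum>i\<in>UNIV. ?P $ i $ i * (x $ i * x $ i))"
        unfolding inner_vec_def diagonal_matrix_vector_component[OF Pd]
        by (simp only: inner_real_def mult_ac)
      moreover have "p * (x \<bullet> x) \<le> (\<Sum>i\<in>UNIV. ?P $ i $ i * (x $ i * x $ i))"
        unfolding inner_vec_def inner_real_def sum_distrib_left
        by (intro sum_mono mult_right_mono ple) simp
      ultimately show ?thesis by simp
    qed
    finally have "r * (x \<bullet> (?B *v x)) < x \<bullet> (?P *v x)" .
    then show ?thesis
      by (simp add: matrix_vector_mult_diff_rdistrib inner_diff_right scaleR_matrix_vector_assoc[symmetric]
          right_diff_distrib)
  qed
  then show ?thesis using \<mu>(1) by blast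
qed

lemma closure_in_V_superset: "S \<subseteq> skew_bilinear_maps \<Longrightarrow> S \<subseteq> closure_in_V S"
  unfolding closure_in_V_def by (rule closure_of_subset) simp

theorem corollary3p4:
  fixes br :: "real^'n \<Rightarrow> real^'n \<Rightarrow> real^'n" and D :: "real^'n^'n"
  assumes "nilpotent_lie_algebra br"
    and "\<not> abelian_lie_algebra br"
    and "D \<in> Der br \<inter> diagonal_matrices"
    and "trace D > 0"
  shows "(ricci_negative br D \<longleftrightarrow>
            D \<in> positive_cone_plus
                  (moment_image (G_orbit D br) \<inter> diagonal_matrices)
                  positive_diagonal_matrices)
       \<and> (ricci_negative br D \<longleftrightarrow>
            D \<in> positive_cone_plus
                  (moment_image (closure_in_V (G_orbit D br)) \<inter> diagonal_matrices)
                  positive_diagonal_matrices)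
       \<and> (\<forall>\<aa>\<in>weyl_chambers D. ricci_negative br D \<longleftrightarrow>
            D \<in> positive_cone_plus
                  (moment_image (closure_in_V (G_orbit D br)) \<inter> \<aa>)
                  positive_diagonal_matrices)"
proof -
  let ?O = "G_orbit D br" and ?pos = "positive_diagonal_matrices :: (real^'n^'n) set"
  let ?cone = "\<lambda>S \<aa>. positive_cone_plus (moment_image S \<inter> \<aa>) ?pos"
  have D: "D \<in> Der br" "D \<in> diagonal_matrices" using assms(3) by auto
  have O: "?O \<subseteq> skew_bilinear_maps"
    using nilpotent_GL_action[OF assms(1)] G_group_subset[of D]
    by (auto simp: G_orbit_def centralizer_GL_def nilpotent_lie_algebra_def intro!: lie_algebra_skew_bilinear)
  have O': "?O \<subseteq> closure_in_V ?O" by (rule closure_in_V_superset[OF O])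
  have mono: "?cone S \<aa> \<subseteq> ?cone S' \<bb>" if "S \<subseteq> S'" "\<aa> \<subseteq> \<bb>" for S S' and \<aa> \<bb> :: "(real^'n^'n) set"
    using that unfolding positive_cone_plus_def moment_image_def by blast
  \<comment> \<open>This is the smallest cone: the orbit without its closure, and a single chamber.
    By \<open>mono\<close> it lies in each cone of the statement, once the chamber is chosen
    accordingly.\<close>
  have to_cone: "D \<in> ?cone ?O \<aa>" if neg: "ricci_negative br D" and a: "\<aa> \<in> weyl_chambers D" for \<aa>
  proof -
    obtain h r where "h \<in> G_group D" and r: "r > 0" and
      "\<And>x. x \<noteq> 0 \<Longrightarrow> x \<bullet> (D *v x) - r * (x \<bullet> (moment_matrix (GL_action h br) *v x)) > 0"
      using neg ricci_negative_iff[OF assms(1) D assms(4)] by blast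
    from orbit_chamber[OF assms(1,2) D a this(1,3)] r
    have "\<exists>\<mu>\<in>?O. \<mu> \<noteq> (\<lambda>x y. 0) \<and> (\<exists>r>0. moment_matrix \<mu> \<in> \<aa> \<and> D - r *\<^sub>R moment_matrix \<mu> \<in> ?pos)"
      by blast
    then show ?thesis
      by (subst positive_cone_plus_moment_image_iff[OF O weyl_chamber_scale[OF a]])
  qed
  \<comment> \<open>This is the largest cone, the closure together with all diagonal matrices; every
    other one lies in it.\<close>
  have from_cone: "ricci_negative br D" if cone: "D \<in> ?cone (closure_in_V ?O) diagonal_matrices"
  proof -
    have "closure_in_V ?O \<subseteq> skew_bilinear_maps"
      unfolding closure_in_V_def using closure_of_subset_topspace by fastforce
    then obtain \<nu> r where "\<nu> \<in> closure_in_V ?O" and r: "r > 0" and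
      "D - r *\<^sub>R moment_matrix \<nu> \<in> ?pos"
      using cone by (subst (asm) positive_cone_plus_moment_image_iff) (auto simp: diagonal_matrices_def)
    from closure_positive_definite[OF this] r show ?thesis
      unfolding ricci_negative_iff[OF assms(1) D assms(4)] by (auto simp: G_orbit_def)
  qed
  \<comment> \<open>The conditions with all diagonal matrices mention no chamber, so one must be
    supplied to pass through the smallest cone.\<close>
  obtain \<aa> where a: "\<aa> \<in> weyl_chambers D" using weyl_chambers_nonempty[of D] by blast
  show ?thesis
    using to_cone from_cone a mono[OF O' order_refl] mono[OF order_refl weyl_chamber_subset]
    by (intro conjI ballI iffI) blast+
qed

end
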